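(* Let $\epsilon\ge0$. Pointwise finite dimensional free $\mathbb R^2$-indexed modules $M$ and $N$ are $\epsilon$-interleaved if and only if there exists an $\epsilon$-matching between $\mathcal B(M)$ and $\mathcal B(N)$.
   Context: Fix a field $k$. An $\mathbb R^2$-indexed module is a functor $M:\mathbb R^2\to\mathrm{Vec}_k$ (product order on $\mathbb R^2$), with internal maps $\varphi_M(a,b):M_a\to M_b$; it is pointwise finite dimensional if each $M_a$ is finite dimensional. For an interval $\mathcal J\subseteq\mathbb R^2$ (nonempty, convex, and connected via finite sequences of comparable elements), $I^{\mathcal J}$ is $k$ on $\mathcal J$, $0$ elsewhere, with identity maps within $\mathcal J$ and zero maps otherwise. $M$ is free if it is isomorphic to a direct sum of modules $I^{\mathcal J}$ with each $\mathcal J$ of the form $\{b\in\mathbb R^2:a\le b\}$, $a\in\mathbb R^2$; the (unique) multiset of these intervals is the barcode $\mathcal B(M)$. $M(\epsilon)_a=M_{a+(\epsilon,\epsilon)}$ and $\varphi_M^\epsilon:M\to M(\epsilon)$ is given by internal maps. $M,N$ are $\epsilon$-interleaved if there are morphisms $f:M\to N(\epsilon)$, $g:N\to M(\epsilon)$ with $g(\epsilon)\circ f=\varphi_M^{2\epsilon}$ and $f(\epsilon)\circ g=\varphi_N^{2\epsilon}$. Intervals $\mathcal J,\mathcal K$ are $\epsilon$-interleaved if $I^{\mathcal J},I^{\mathcal K}$ are; $\mathcal J$ is $\epsilon$-trivial if $\varphi^\epsilon_{I^{\mathcal J}}=0$. An $\epsilon$-matching between barcodes $\mathcal C,\mathcal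 D$ is a bijection $\sigma$ from a sub-multiset $\mathcal C'\subseteq\mathcal C$ to a sub-multiset $\mathcal D'\subseteq\mathcal D$, such that $\mathcal C'$ and $\mathcal D'$ contain all non-$2\epsilon$-trivial intervals of $\mathcal C$ and $\mathcal D$ respectively, and $\mathcal J,\sigma(\mathcal J)$ are $\epsilon$-interleaved for every $\mathcal J\in\mathcal C'$. *)

theory Defs
  imports
    Complex_Main
    "HOL-Library.FuncSet"
    "HOL-Library.Product_Order"
    "HOL-Library.Product_Plus"
    "Jordan_Normal_Form.Missing_VectorSpace"
begin

text \<open>
  The indexing poset is \<^typ>\<open>real \<times> real\<close> with the componentwise order and addition of
  \<^theory>\<open>HOL-Library.Product_Order\<close> and \<^theory>\<open>HOL-Library.Product_Plus\<close>.
  Vector spaces over a field \<open>K\<close> are those of the AFP entry VectorSpace, i.e. records whose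
  elements are those of their carrier. Accordingly the value of a linear map outside
  the carrier of its domain is irrelevant, and equality of maps is always tested on carriers only.
\<close>

section \<open>Modules indexed by the plane\<close>

record ('k, 'v) persmod =
  obj :: "real \<times> real \<Rightarrow> ('k, 'v) module"
  imap :: "real \<times> real \<Rightarrow> real \<times> real \<Rightarrow> 'v \<Rightarrow> 'v"

locale persistence_module =
  fixes K :: "('k, 'r) ring_scheme" and M :: "('k, 'v) persmod"
  assumes vectorspace_obj: "vectorspace K (obj M a)"
    and linear_imap: "a \<le> b \<Longrightarrow> linear_map K (obj M a) (obj M b) (imap M a b)"
    and imap_id: "x \<in> carrier (obj M a) \<Longrightarrow> imap M a a x = x"
    and imap_comp: "a \<le> b \<Longrightarrow> b \<le> c \<Longrightarrow> x \<in> carrier (obj M a)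
      \<Longrightarrow> imap M b c (imap M a b x) = imap M a c x"

definition pointwise_fin_dim :: "('k, 'r) ring_scheme \<Rightarrow> ('k, 'v) persmod \<Rightarrow> bool" where
  "pointwise_fin_dim K M \<longleftrightarrow> (\<forall>a. vectorspace.fin_dim K (obj M a))"

definition pm_hom ::
  "('k, 'r) ring_scheme \<Rightarrow> ('k, 'v) persmod \<Rightarrow> ('k, 'w) persmod \<Rightarrow> (real \<times> real \<Rightarrow> 'v \<Rightarrow> 'w) \<Rightarrow> bool"
  where "pm_hom K M N f \<longleftrightarrow>
    (\<forall>a. linear_map K (obj M a) (obj N a) (f a)) \<and>
    (\<forall>a b. a \<le> b \<longrightarrow> (\<forall>x\<in>carrier (obj M a). f b (imap M a b x) = imap N a b (f a x)))"

definition pm_eq ::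
  "('k, 'v) persmod \<Rightarrow> (real \<times> real \<Rightarrow> 'v \<Rightarrow> 'w) \<Rightarrow> (real \<times> real \<Rightarrow> 'v \<Rightarrow> 'w) \<Rightarrow> bool"
  where "pm_eq M f g \<longleftrightarrow> (\<forall>a. \<forall>x\<in>carrier (obj M a). f a x = g a x)"

definition pm_comp ::
  "(real \<times> real \<Rightarrow> 'v \<Rightarrow> 'w) \<Rightarrow> (real \<times> real \<Rightarrow> 'u \<Rightarrow> 'v) \<Rightarrow> real \<times> real \<Rightarrow> 'u \<Rightarrow> 'w"
  where "pm_comp g f a = g a \<circ> f a"

definition pm_isomorphic ::
  "('k, 'r) ring_scheme \<Rightarrow> ('k, 'v) persmod \<Rightarrow> ('k, 'w) persmod \<Rightarrow> bool" where
  "pm_isomorphic K M N \<longleftrightarrow> (\<exists>f g. pm_hom K M N f \<and> pm_hom K N M g \<and>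
     pm_eq M (pm_comp g f) (\<lambda>a x. x) \<and> pm_eq N (pm_comp f g) (\<lambda>a x. x))"

section \<open>Interval modules and direct sums\<close>

definition poset_interval :: "(real \<times> real) set \<Rightarrow> bool" where
  "poset_interval J \<longleftrightarrow> J \<noteq> {} \<and>
     (\<forall>a\<in>J. \<forall>c\<in>J. \<forall>b. a \<le> b \<and> b \<le> c \<longrightarrow> b \<in> J) \<and>
     (\<forall>a\<in>J. \<forall>b\<in>J. (a, b) \<in> {(x, y). x \<in> J \<and> y \<in> J \<and> (x \<le> y \<or> y \<le> x)}\<^sup>*)"

text \<open>
  The fields \<^const>\<open>monoid.mult\<close> and \<^const>\<open>monoid.one\<close> of a module record carry no
  meaning for a vector space; as in the VectorSpace entry they are filled with zeros.
\<close>

definition interval_pm :: "('k, 'r) ring_scheme \<Rightarrow> (real \<times> real) set \<Rightarrow> ('k, 'k) persmod" where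
  "interval_pm K J = \<lparr>
     obj = (\<lambda>a. \<lparr>carrier = (if a \<in> J then carrier K else {\<zero>\<^bsub>K\<^esub>}),
       mult = (\<lambda>x y. \<zero>\<^bsub>K\<^esub>), one = \<zero>\<^bsub>K\<^esub>, zero = \<zero>\<^bsub>K\<^esub>,
       add = (\<lambda>x y. x \<oplus>\<^bsub>K\<^esub> y), smult = (\<lambda>c x. c \<otimes>\<^bsub>K\<^esub> x)\<rparr>),
     imap = (\<lambda>a b x. if a \<in> J \<and> b \<in> J then x else \<zero>\<^bsub>K\<^esub>)\<rparr>"

definition pm_dsum :: "'i set \<Rightarrow> ('i \<Rightarrow> ('k, 'v) persmod) \<Rightarrow> ('k, 'i \<Rightarrow> 'v) persmod" where
  "pm_dsum I P = \<lparr>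
     obj = (\<lambda>a. \<lparr>carrier = {x \<in> \<Pi>\<^sub>E i\<in>I. carrier (obj (P i) a).
         finite {i \<in> I. x i \<noteq> \<zero>\<^bsub>obj (P i) a\<^esub>}},
       mult = (\<lambda>x y. \<lambda>i\<in>I. \<zero>\<^bsub>obj (P i) a\<^esub>),
       one = (\<lambda>i\<in>I. \<zero>\<^bsub>obj (P i) a\<^esub>),
       zero = (\<lambda>i\<in>I. \<zero>\<^bsub>obj (P i) a\<^esub>),
       add = (\<lambda>x y. \<lambda>i\<in>I. x i \<oplus>\<^bsub>obj (P i) a\<^esub> y i),
       smult = (\<lambda>c x. \<lambda>i\<in>I. c \<odot>\<^bsub>obj (P i) a\<^esub> x i)\<rparr>),
     imap = (\<lambda>a b x. \<lambda>i\<in>I. imap (P i) a b (x i))\<rparr>"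

section \<open>Free modules and barcodes\<close>

definition free_decomposition ::
  "('k, 'r) ring_scheme \<Rightarrow> ('k, 'v) persmod \<Rightarrow> 'i set \<Rightarrow> ('i \<Rightarrow> (real \<times> real) set) \<Rightarrow> bool" where
  "free_decomposition K M I J \<longleftrightarrow>
     (\<forall>i\<in>I. \<exists>a. J i = {b. a \<le> b}) \<and>
     pm_isomorphic K M (pm_dsum I (\<lambda>i. interval_pm K (J i)))"

text \<open>
  A direct sum may be indexed by any set, but HOL cannot quantify over the type of the index set
  inside a definition. The type \<open>(real \<times> real) \<times> 'v\<close> used below is large enough: the summand
  \<open>{b. a \<le> b}\<close> may be indexed by \<open>a\<close> together with the element of \<open>obj M a :: 'v\<close> generating it.
\<close>

definition free_pm :: "('k, 'r) ring_scheme \<Rightarrow> ('k, 'v) persmod \<Rightarrow> bool" where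
  "free_pm K M \<longleftrightarrow> (\<exists>(I :: ((real \<times> real) \<times> 'v) set) J. free_decomposition K M I J)"

text \<open>
  A multiset of intervals, possibly infinite, is given by its multiplicity function. Natural
  numbers suffice as multiplicities for pointwise finite dimensional modules: only finitely many
  summands of a decomposition contain a given point, so no infinite set occurs under
  \<^const>\<open>card\<close>. \<open>barcode\<close> is meaningful for free pointwise finite dimensional modules only.
\<close>

type_synonym interval_multiset = "(real \<times> real) set \<Rightarrow> nat"

definition barcode :: "('k, 'r) ring_scheme \<Rightarrow> ('k, 'v) persmod \<Rightarrow> interval_multiset" where
  "barcode K M = (THE C. \<exists>(I :: ((real \<times> real) \<times> 'v) set) J.
     free_decomposition K M I J \<and> C = (\<lambda>\<J>. card {i \<in> I. J i = \<J>}))"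

text \<open>The elements of a multiset, with multiple copies told apart by a number.\<close>

definition copies :: "interval_multiset \<Rightarrow> ((real \<times> real) set \<times> nat) set" where
  "copies C = {(\<J>, n). n < C \<J>}"

section \<open>Interleavings and matchings\<close>

definition pm_shift :: "real \<Rightarrow> ('k, 'v) persmod \<Rightarrow> ('k, 'v) persmod" where
  "pm_shift \<epsilon> M = \<lparr>obj = (\<lambda>a. obj M (a + (\<epsilon>, \<epsilon>))),
     imap = (\<lambda>a b. imap M (a + (\<epsilon>, \<epsilon>)) (b + (\<epsilon>, \<epsilon>)))\<rparr>"

definition hom_shift :: "real \<Rightarrow> (real \<times> real \<Rightarrow> 'v \<Rightarrow> 'w) \<Rightarrow> real \<times> real \<Rightarrow> 'v \<Rightarrow> 'w" where
  "hom_shift \<epsilon> f a = f (a + (\<epsilon>, \<epsilon>))"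

definition trans_hom :: "real \<Rightarrow> ('k, 'v) persmod \<Rightarrow> real \<times> real \<Rightarrow> 'v \<Rightarrow> 'v" where
  "trans_hom \<epsilon> M a = imap M a (a + (\<epsilon>, \<epsilon>))"

definition interleaved ::
  "('k, 'r) ring_scheme \<Rightarrow> real \<Rightarrow> ('k, 'v) persmod \<Rightarrow> ('k, 'w) persmod \<Rightarrow> bool" where
  "interleaved K \<epsilon> M N \<longleftrightarrow> (\<exists>f g.
     pm_hom K M (pm_shift \<epsilon> N) f \<and> pm_hom K N (pm_shift \<epsilon> M) g \<and>
     pm_eq M (pm_comp (hom_shift \<epsilon> g) f) (trans_hom (2 * \<epsilon>) M) \<and>
     pm_eq N (pm_comp (hom_shift \<epsilon> f) g) (trans_hom (2 * \<epsilon>) N))"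

definition intervals_interleaved ::
  "('k, 'r) ring_scheme \<Rightarrow> real \<Rightarrow> (real \<times> real) set \<Rightarrow> (real \<times> real) set \<Rightarrow> bool" where
  "intervals_interleaved K \<epsilon> \<J> \<K> \<longleftrightarrow> interleaved K \<epsilon> (interval_pm K \<J>) (interval_pm K \<K>)"

definition interval_trivial :: "('k, 'r) ring_scheme \<Rightarrow> real \<Rightarrow> (real \<times> real) set \<Rightarrow> bool" where
  "interval_trivial K \<epsilon> \<J> \<longleftrightarrow>
     pm_eq (interval_pm K \<J>) (trans_hom \<epsilon> (interval_pm K \<J>)) (\<lambda>a x. \<zero>\<^bsub>K\<^esub>)"

definition is_matching ::
  "('k, 'r) ring_scheme \<Rightarrow> real \<Rightarrow> interval_multiset \<Rightarrow> interval_multiset \<Rightarrow>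
   ((real \<times> real) set \<times> nat) set \<Rightarrow> ((real \<times> real) set \<times> nat) set \<Rightarrow>
   ((real \<times> real) set \<times> nat \<Rightarrow> (real \<times> real) set \<times> nat) \<Rightarrow> bool" where
  "is_matching K \<epsilon> C D C' D' \<sigma> \<longleftrightarrow>
     C' \<subseteq> copies C \<and> D' \<subseteq> copies D \<and> bij_betw \<sigma> C' D' \<and>
     (\<forall>p\<in>copies C. \<not> interval_trivial K (2 * \<epsilon>) (fst p) \<longrightarrow> p \<in> C') \<and>
     (\<forall>q\<in>copies D. \<not> interval_trivial K (2 * \<epsilon>) (fst q) \<longrightarrow> q \<in> D') \<and>
     (\<forall>p\<in>C'. intervals_interleaved K \<epsilon> (fst p) (fst (\<sigma> p)))"

section \<open>The constructions above are well-defined\<close>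

lemma poset_interval_upset: "poset_interval {b. a \<le> (b :: real \<times> real)}"
proof -
  let ?R = "{(x, y). x \<in> {b. a \<le> b} \<and> y \<in> {b. a \<le> b} \<and> (x \<le> y \<or> y \<le> x)}"
  have "(x, y) \<in> ?R\<^sup>*" if "a \<le> x" "a \<le> y" for x y :: "real \<times> real"
  proof (rule rtrancl_trans)
    show "(x, a) \<in> ?R\<^sup>*" "(a, y) \<in> ?R\<^sup>*" using that by (auto intro!: r_into_rtrancl)
  qed
  then show ?thesis
    unfolding poset_interval_def by (intro conjI) (blast intro: order_trans)+
qed

lemma vectorspace_interval_pm:
  assumes "field K"
  shows "vectorspace K (obj (interval_pm K J) a)"
proof -
  interpret field K by fact
  have "abelian_group (obj (interval_pm K J) a)"
  proof (rule abelian_groupI)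
    fix x assume x: "x \<in> carrier (obj (interval_pm K J) a)"
    show "\<exists>y\<in>carrier (obj (interval_pm K J) a). y \<oplus>\<^bsub>obj (interval_pm K J) a\<^esub> x = \<zero>\<^bsub>obj (interval_pm K J) a\<^esub>"
      using x by (intro bexI[of _ "\<ominus>\<^bsub>K\<^esub> x"]) (auto simp: interval_pm_def l_neg split: if_splits)
  qed (auto simp: interval_pm_def a_ac split: if_splits)
  then have "module K (obj (interval_pm K J) a)"
    by (intro moduleI is_cring) (auto simp: interval_pm_def l_distr r_distr m_assoc split: if_splits)
  then show ?thesis by (simp add: vectorspace_def field_axioms)
qed

lemma persistence_module_interval_pm:
  assumes "field K" and "poset_interval J"
  shows "persistence_module K (interval_pm K J)"
proof (rule persistence_module.intro)
  interpret field K by fact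
  fix a b c :: "real \<times> real" and x :: 'a
  have v: "vectorspace K (obj (interval_pm K J) a)" for a
    by (rule vectorspace_interval_pm) fact
  then show "vectorspace K (obj (interval_pm K J) a)" .
  show "linear_map K (obj (interval_pm K J) a) (obj (interval_pm K J) b) (imap (interval_pm K J) a b)"
    using v[of a] v[of b]
    by (auto simp: linear_map_def mod_hom_def mod_hom_axioms_def module_hom_def vectorspace_def)
      (auto simp: interval_pm_def)
  show "x \<in> carrier (obj (interval_pm K J) a) \<Longrightarrow> imap (interval_pm K J) a a x = x"
    by (auto simp: interval_pm_def)
  assume "a \<le> b" "b \<le> c" and x: "x \<in> carrier (obj (interval_pm K J) a)"
  then have "b \<in> J" if "a \<in> J" "c \<in> J"
    using assms(2) that unfolding poset_interval_def by blast
  with x show "imap (interval_pm K J) b c (imap (interval_pm K J) a b x) = imap (interval_pm K J) a c x"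
    by (auto simp: interval_pm_def)
qed

lemma persistence_module_pm_dsum:
  assumes K: "field K" and P: "\<And>i. i \<in> I \<Longrightarrow> persistence_module K (P i)"
  shows "persistence_module K (pm_dsum I P)"
proof (rule persistence_module.intro)
  fix a b c :: "real \<times> real" and x
  have vs: "vectorspace K (obj (P i) a)" if "i \<in> I" for i a
    using P[OF that] by (rule persistence_module.vectorspace_obj)
  then have md: "module K (obj (P i) a)" if "i \<in> I" for i a
    using that by (simp add: vectorspace_def)
  then have ag: "abelian_group (obj (P i) a)" if "i \<in> I" for i a
    using that by (simp add: module_def)
  note cm = ag[THEN abelian_group.axioms(1)]
  have lin: "linear_map K (obj (P i) a) (obj (P i) b) (imap (P i) a b)" if "i \<in> I" "a \<le> b" for i a b
    using P[OF that(1)] that(2) by (rule persistence_module.linear_imap)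
  have imap0: "imap (P i) a b \<zero>\<^bsub>obj (P i) a\<^esub> = \<zero>\<^bsub>obj (P i) b\<^esub>" if "i \<in> I" "a \<le> b" for i a b
    using linear_map.T0_is_0[OF lin[OF that]] .
  have hom: "imap (P i) a b \<in> module_hom K (obj (P i) a) (obj (P i) b)" if "i \<in> I" "a \<le> b" for i a b
    using lin[OF that] by (simp add: linear_map_def mod_hom_def mod_hom_axioms_def)
  have sm0: "r \<odot>\<^bsub>obj (P i) a\<^esub> \<zero>\<^bsub>obj (P i) a\<^esub> = \<zero>\<^bsub>obj (P i) a\<^esub>" if "i \<in> I" "r \<in> carrier K" for i a r
    using module.smult_r_null[OF md] that by blast
  have minus0: "\<ominus>\<^bsub>obj (P i) a\<^esub> \<zero>\<^bsub>obj (P i) a\<^esub> = \<zero>\<^bsub>obj (P i) a\<^esub>" if "i \<in> I" for i a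
    by (metis ag cm abelian_group.r_neg abelian_group.a_inv_closed abelian_monoid.l_zero
        abelian_monoid.zero_closed that)
  let ?V = "\<lambda>a. obj (pm_dsum I P) a"
  have mem: "x i \<in> carrier (obj (P i) a)" if "x \<in> carrier (?V a)" "i \<in> I" for x a i
    using that by (auto simp: pm_dsum_def)
  have ext: "x \<in> extensional I" if "x \<in> carrier (?V a)" for x a
    using that by (auto simp: pm_dsum_def PiE_def)
  have fs: "finite {i \<in> I. x i \<noteq> \<zero>\<^bsub>obj (P i) a\<^esub>}" if "x \<in> carrier (?V a)" for x a
    using that by (auto simp: pm_dsum_def)
  have memI: "(\<lambda>i\<in>I. g i) \<in> carrier (?V a)"
    if "\<And>i. i \<in> I \<Longrightarrow> g i \<in> carrier (obj (P i) a)" "finite {i \<in> I. g i \<noteq> \<zero>\<^bsub>obj (P i) a\<^esub>}" for g a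
  proof -
    have "{i \<in> I. (\<lambda>i\<in>I. g i) i \<noteq> \<zero>\<^bsub>obj (P i) a\<^esub>} = {i \<in> I. g i \<noteq> \<zero>\<^bsub>obj (P i) a\<^esub>}" by auto
    then show ?thesis using that by (simp add: pm_dsum_def)
  qed
  have add: "x \<oplus>\<^bsub>?V a\<^esub> y = (\<lambda>i\<in>I. x i \<oplus>\<^bsub>obj (P i) a\<^esub> y i)" for x y a
    by (simp add: pm_dsum_def)
  have zero: "\<zero>\<^bsub>?V a\<^esub> = (\<lambda>i\<in>I. \<zero>\<^bsub>obj (P i) a\<^esub>)" for a
    by (simp add: pm_dsum_def)
  have smult: "r \<odot>\<^bsub>?V a\<^esub> x = (\<lambda>i\<in>I. r \<odot>\<^bsub>obj (P i) a\<^esub> x i)" for r x a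
    by (simp add: pm_dsum_def)
  have imap: "imap (pm_dsum I P) a b x = (\<lambda>i\<in>I. imap (P i) a b (x i))" for a b x
    by (simp add: pm_dsum_def)
  have c_add: "x \<oplus>\<^bsub>?V a\<^esub> y \<in> carrier (?V a)" if "x \<in> carrier (?V a)" "y \<in> carrier (?V a)" for x y a
    unfolding add
  proof (rule memI)
    show "finite {i \<in> I. x i \<oplus>\<^bsub>obj (P i) a\<^esub> y i \<noteq> \<zero>\<^bsub>obj (P i) a\<^esub>}"
      by (rule finite_subset[of _ "{i \<in> I. x i \<noteq> \<zero>\<^bsub>obj (P i) a\<^esub>} \<union> {i \<in> I. y i \<noteq> \<zero>\<^bsub>obj (P i) a\<^esub>}"])
        (use fs[OF that(1)] fs[OF that(2)] cm[of _ a] in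
          \<open>auto simp: abelian_monoid.l_zero abelian_monoid.zero_closed\<close>)
  qed (use that mem[of _ a] cm[of _ a] in \<open>auto intro: abelian_monoid.a_closed\<close>)
  have c_zero: "\<zero>\<^bsub>?V a\<^esub> \<in> carrier (?V a)" for a
    unfolding zero by (rule memI) (use cm[of _ a] in \<open>auto intro: abelian_monoid.zero_closed\<close>)
  have c_smult: "r \<odot>\<^bsub>?V a\<^esub> x \<in> carrier (?V a)" if "r \<in> carrier K" "x \<in> carrier (?V a)" for r x a
    unfolding smult
  proof (rule memI)
    show "finite {i \<in> I. r \<odot>\<^bsub>obj (P i) a\<^esub> x i \<noteq> \<zero>\<^bsub>obj (P i) a\<^esub>}"
      by (rule finite_subset[OF _ fs[OF that(2)]]) (use sm0[of _ r a] that in auto)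
  qed (use that mem[of _ a] md[of _ a] in \<open>auto intro: module.smult_closed\<close>)
  have c_imap: "imap (pm_dsum I P) a b x \<in> carrier (?V b)" if "a \<le> b" "x \<in> carrier (?V a)" for a b x
    unfolding imap
  proof (rule memI)
    show "finite {i \<in> I. imap (P i) a b (x i) \<noteq> \<zero>\<^bsub>obj (P i) b\<^esub>}"
      by (rule finite_subset[OF _ fs[OF that(2)]]) (use imap0[of _ a b] that in auto)
    show "imap (P i) a b (x i) \<in> carrier (obj (P i) b)" if "i \<in> I" for i
      using module_hom_closed[OF hom[OF that \<open>a \<le> b\<close>]] mem[OF \<open>x \<in> _\<close> that] by auto
  qed
  have eqI: "x = y" if "x \<in> carrier (?V a)" "y \<in> carrier (?V a)" "\<And>i. i \<in> I \<Longrightarrow> x i = y i" for x y a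
    using ext[OF that(1)] ext[OF that(2)] that(3) by (rule extensionalityI)
  have "abelian_group (?V a)" for a
  proof (rule abelian_groupI)
    fix x y z assume x: "x \<in> carrier (?V a)" and y: "y \<in> carrier (?V a)" and z: "z \<in> carrier (?V a)"
    note m = mem[OF x] mem[OF y] mem[OF z]
    show "x \<oplus>\<^bsub>?V a\<^esub> y \<oplus>\<^bsub>?V a\<^esub> z = x \<oplus>\<^bsub>?V a\<^esub> (y \<oplus>\<^bsub>?V a\<^esub> z)"
      by (rule eqI[where a = a]; (intro c_add x y z)?; simp add: add m abelian_monoid.a_assoc[OF cm])
    show "x \<oplus>\<^bsub>?V a\<^esub> y = y \<oplus>\<^bsub>?V a\<^esub> x"
      by (rule eqI[where a = a]; (intro c_add x y)?; simp add: add m abelian_monoid.a_comm[OF cm])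
  next
    fix x assume x: "x \<in> carrier (?V a)"
    note m = mem[OF x]
    show "\<zero>\<^bsub>?V a\<^esub> \<oplus>\<^bsub>?V a\<^esub> x = x"
      by (rule eqI[where a = a]; (intro c_add c_zero x)?;
          simp add: add zero m abelian_monoid.l_zero[OF cm])
    let ?y = "\<lambda>i\<in>I. \<ominus>\<^bsub>obj (P i) a\<^esub> x i"
    have y: "?y \<in> carrier (?V a)"
    proof (rule memI)
      show "finite {i \<in> I. \<ominus>\<^bsub>obj (P i) a\<^esub> x i \<noteq> \<zero>\<^bsub>obj (P i) a\<^esub>}"
        by (rule finite_subset[OF _ fs[OF x]]) (auto simp: minus0)
    qed (simp add: m abelian_group.a_inv_closed[OF ag])
    show "\<exists>y\<in>carrier (?V a). y \<oplus>\<^bsub>?V a\<^esub> x = \<zero>\<^bsub>?V a\<^esub>"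
      by (rule bexI[OF _ y], rule eqI[where a = a]; (intro c_add c_zero x y)?;
          simp add: add zero m abelian_group.l_neg[OF ag])
  qed (auto intro: c_add c_zero)
  moreover have "cring K" using K by (simp add: field_def domain_def)
  ultimately have "module K (?V a)" for a
  proof (intro moduleI)
    fix r s x y assume r: "r \<in> carrier K" and s: "s \<in> carrier K"
      and x: "x \<in> carrier (?V a)" and y: "y \<in> carrier (?V a)"
    note m = r s mem[OF x] mem[OF y]
    have rs: "r \<oplus>\<^bsub>K\<^esub> s \<in> carrier K" "r \<otimes>\<^bsub>K\<^esub> s \<in> carrier K"
      using \<open>cring K\<close> r s by (auto simp: cring_def intro: ring.ring_simprules)
    show "(r \<oplus>\<^bsub>K\<^esub> s) \<odot>\<^bsub>?V a\<^esub> x = r \<odot>\<^bsub>?V a\<^esub> x \<oplus>\<^bsub>?V a\<^esub> s \<odot>\<^bsub>?V a\<^esub> x"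
      by (rule eqI[where a = a]; (intro c_add c_smult r s rs x)?;
          simp add: add smult m module.smult_l_distr[OF md])
    show "r \<odot>\<^bsub>?V a\<^esub> (x \<oplus>\<^bsub>?V a\<^esub> y) = r \<odot>\<^bsub>?V a\<^esub> x \<oplus>\<^bsub>?V a\<^esub> r \<odot>\<^bsub>?V a\<^esub> y"
      by (rule eqI[where a = a]; (intro c_add c_smult r x y)?;
          simp add: add smult m module.smult_r_distr[OF md])
    show "(r \<otimes>\<^bsub>K\<^esub> s) \<odot>\<^bsub>?V a\<^esub> x = r \<odot>\<^bsub>?V a\<^esub> (s \<odot>\<^bsub>?V a\<^esub> x)"
      by (rule eqI[where a = a]; (intro c_smult r s rs x)?;
          simp add: smult m module.smult_assoc1[OF md])
  next
    fix x assume x: "x \<in> carrier (?V a)"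
    have one: "\<one>\<^bsub>K\<^esub> \<in> carrier K"
      using \<open>cring K\<close> by (auto simp: cring_def intro: ring.ring_simprules)
    show "\<one>\<^bsub>K\<^esub> \<odot>\<^bsub>?V a\<^esub> x = x"
      by (rule eqI[where a = a]; (intro c_smult one x)?;
          simp add: smult mem[OF x] module.smult_one[OF md])
  qed (auto intro: c_smult)
  then have v: "vectorspace K (?V a)" for a
    using K by (simp add: vectorspace_def)
  then show "vectorspace K (?V a)" .
  show "linear_map K (?V a) (?V b) (imap (pm_dsum I P) a b)" if ab: "a \<le> b"
  proof -
    note h = hom[OF _ ab]
    have "imap (pm_dsum I P) a b (x \<oplus>\<^bsub>?V a\<^esub> y) =
        imap (pm_dsum I P) a b x \<oplus>\<^bsub>?V b\<^esub> imap (pm_dsum I P) a b y"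
      if x: "x \<in> carrier (?V a)" and y: "y \<in> carrier (?V a)" for x y
      by (rule eqI[where a = b]; (intro c_add c_imap ab x y)?;
          simp add: add imap mem[OF x] mem[OF y] module_hom_add[OF h])
    moreover have "imap (pm_dsum I P) a b (r \<odot>\<^bsub>?V a\<^esub> x) = r \<odot>\<^bsub>?V b\<^esub> imap (pm_dsum I P) a b x"
      if r: "r \<in> carrier K" and x: "x \<in> carrier (?V a)" for r x
      by (rule eqI[where a = b]; (intro c_smult c_imap ab r x)?;
          simp add: smult imap r mem[OF x] module_hom_smult[OF h])
    ultimately show ?thesis
      using v[of a] v[of b] c_imap[OF ab]
      by (simp add: linear_map_def mod_hom_def mod_hom_axioms_def module_hom_def vectorspace_def)
  qed
  show "imap (pm_dsum I P) a a x = x" if x: "x \<in> carrier (?V a)"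
    by (rule eqI[where a = a]; (intro c_imap order_refl x)?;
        simp add: imap mem[OF x] persistence_module.imap_id[OF P])
  show "imap (pm_dsum I P) b c (imap (pm_dsum I P) a b x) = imap (pm_dsum I P) a c x"
    if ab: "a \<le> b" and bc: "b \<le> c" and x: "x \<in> carrier (?V a)"
  proof (rule eqI[where a = c])
    show "imap (pm_dsum I P) b c (imap (pm_dsum I P) a b x) \<in> carrier (?V c)"
      by (intro c_imap ab bc x)
    show "imap (pm_dsum I P) a c x \<in> carrier (?V c)"
      by (intro c_imap order_trans[OF ab bc] x)
  qed (simp add: imap mem[OF x] persistence_module.imap_comp[OF P ab bc])
qed

end

theory Submission
  imports Defs
begin

text \<open>
  In terms of generators \<open>a i\<close> of \<open>M\<close> and \<open>b j\<close> of \<open>N\<close>, an interleaving is a pair of matrices \<open>F\<close>, \<open>G\<close>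
  with \<open>F G = 1\<close> and \<open>G F = 1\<close>, where \<open>F i j \<noteq> 0\<close> only if \<open>b j \<le> a i + \<epsilon>\<close> and \<open>G j i \<noteq> 0\<close> only if
  \<open>a i \<le> b j + \<epsilon>\<close>. If \<open>F i j \<cdot> G j i' \<noteq> 0\<close> and the coordinate sum of \<open>a i\<close> is at most that of \<open>a i'\<close>, then
  \<open>b j\<close> has distance at most \<open>\<epsilon>\<close> from \<open>a i\<close> or from \<open>a i'\<close>. So for a finite set \<open>A\<close> of generators of \<open>M\<close>, ordered
  by coordinate sum, the columns of \<open>F\<close> at generators of \<open>N\<close> close to \<open>A\<close> already yield a
  unitriangular product, whence there are at least \<open>card A\<close> of them. This is Hall's condition.
  Infinite barcodes are handled by Hall's theorem for locally finite graphs, applied in both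
  directions, and a Schroeder--Bernstein argument. The case \<open>\<epsilon> = 0\<close>, applied to two decompositions of the same
  module, shows that the barcode is well-defined.
\<close>

declare split_paired_All [simp del] split_paired_Ex [simp del]

section \<open>Matchings in infinite bipartite graphs\<close>

text \<open>Schroeder--Bernstein, recording that every value of \<open>h\<close> comes from
  \<open>f\<close> or from the inverse of \<open>g\<close>; if both injections follow the edges of a
  graph, so does \<open>h\<close>.\<close>

lemma bij_betw_from_two_injections:
  assumes "inj_on f A" "f ` A \<subseteq> B" "inj_on g B" "g ` B \<subseteq> A"
  shows "\<exists>h. bij_betw h A B \<and> (\<forall>x\<in>A. h x = f x \<or> g (h x) = x)"
proof -
  \<comment> \<open>Two nested complements make the operator monotone. \<open>X\<close> collects
    what is reached by iterating \<open>g\<close> after \<open>f\<close> from the points of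
    \<open>A\<close> outside the range of \<open>g\<close>; there \<open>h\<close> has to be
    \<open>f\<close>.\<close>
  define X where "X = lfp (\<lambda>X. A - g ` (B - f ` X))"
  have X: "X = A - g ` (B - f ` X)"
    unfolding X_def by (rule lfp_unfold) (blast intro: monoI)
  have compl: "A - X = g ` (B - f ` X)"
    using X assms(4) by blast
  define h where "h x = (if x \<in> X then f x else the_inv_into B g x)" for x
  have g_inv: "the_inv_into B g (g y) = y" if "y \<in> B" for y
    using that assms(3) by (simp add: the_inv_into_f_f)
  have "bij_betw f X (f ` X)"
    using assms(1) X by (metis Diff_subset bij_betw_imageI inj_on_subset)
  then have bX: "bij_betw h X (f ` X)"
    by (rule bij_betw_cong[THEN iffD1, rotated]) (simp add: h_def)
  have bC: "bij_betw h (A - X) (B - f ` X)"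
  proof (rule bij_betwI[where g = g])
    show "h \<in> A - X \<rightarrow> B - f ` X"
      unfolding compl by (smt (verit) DiffD1 Pi_I g_inv h_def compl imageE Diff_iff image_eqI)
    show "g \<in> B - f ` X \<rightarrow> A - X" using compl by blast
    show "g (h x) = x" if "x \<in> A - X" for x
      using that f_the_inv_into_f[OF assms(3)] compl by (auto simp: h_def)
    show "h (g y) = y" if "y \<in> B - f ` X" for y
      using that compl g_inv by (auto simp: h_def)
  qed
  have "bij_betw h (X \<union> (A - X)) (f ` X \<union> (B - f ` X))"
    using bX bC by (rule bij_betw_combine) auto
  moreover have "X \<union> (A - X) = A" "f ` X \<union> (B - f ` X) = B"
    using X assms(2) by blast+
  moreover have "h x = f x \<or> g (h x) = x" if "x \<in> A" for x
    using that compl f_the_inv_into_f[OF assms(3), of x] by (auto simp: h_def)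
  ultimately show ?thesis by metis
qed

text \<open>Rado's argument: in an edge-minimal graph satisfying Hall's condition, two edges at a vertex \<open>x\<close>
  would yield two critical sets whose union and intersection contradict submodularity.\<close>

lemma marriage_minimal:
  assumes fin: "\<And>i. i \<in> I \<Longrightarrow> finite (E i)"
    and hall: "\<And>A. A \<subseteq> I \<Longrightarrow> finite A \<Longrightarrow> card A \<le> card (\<Union>(E ` A))"
    and min: "\<And>x y. x \<in> I \<Longrightarrow> y \<in> E x \<Longrightarrow>
      \<exists>A. A \<subseteq> I \<and> finite A \<and> card (\<Union>((E(x := E x - {y})) ` A)) < card A"
  shows "\<exists>f. inj_on f I \<and> (\<forall>i\<in>I. f i \<in> E i)"
proof -
  \<comment> \<open>Deleting the edge from \<open>x\<close> to \<open>y\<close> breaks Hall's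
    condition on a set that must contain \<open>x\<close>. Dropping \<open>x\<close> lowers its size
    by one, which weakens the strict inequality to the one stated.\<close>
  have crit: "\<exists>A. A \<subseteq> I \<and> finite A \<and> x \<notin> A \<and> card (\<Union>(E ` A) \<union> (E x - {y})) \<le> card A"
    if xy: "x \<in> I" "y \<in> E x" for x y
  proof -
    obtain A where A: "A \<subseteq> I" "finite A" and lt: "card (\<Union>((E(x := E x - {y})) ` A)) < card A"
      using min[OF xy] by blast
    have "x \<in> A"
    proof (rule ccontr)
      assume "x \<notin> A"
      then have "(E(x := E x - {y})) ` A = E ` A" by auto
      then show False using lt hall[OF A] by simp
    qed
    have eq: "\<Union>((E(x := E x - {y})) ` A) = \<Union>(E ` (A - {x})) \<union> (E x - {y})"
      using \<open>x \<in> A\<close> by (auto split: if_splits)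
    have "card (A - {x}) = card A - 1" using \<open>x \<in> A\<close> by simp
    then have "card (\<Union>(E ` (A - {x})) \<union> (E x - {y})) \<le> card (A - {x})"
      using lt unfolding eq by linarith
    then show ?thesis
      using A by (intro exI[of _ "A - {x}"]) blast
  qed
  have uniq: "y = y'" if x: "x \<in> I" and y: "y \<in> E x" "y' \<in> E x" for x y y'
  proof (rule ccontr)
    assume "y \<noteq> y'"
    obtain A A' where A: "A \<subseteq> I" "finite A" "x \<notin> A" "card (\<Union>(E ` A) \<union> (E x - {y})) \<le> card A"
      and A': "A' \<subseteq> I" "finite A'" "x \<notin> A'" "card (\<Union>(E ` A') \<union> (E x - {y'})) \<le> card A'"
      using crit x y by meson
    let ?P = "\<Union>(E ` A) \<union> (E x - {y})" and ?P' = "\<Union>(E ` A') \<union> (E x - {y'})"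
    have finP: "finite ?P" "finite ?P'"
      using fin x A(1,2) A'(1,2) by auto
    \<comment> \<open>As \<open>y \<noteq> y'\<close>, the union of \<open>?P\<close> and
      \<open>?P'\<close> contains all of \<open>E x\<close>. Hall's condition for the union may
      therefore include \<open>x\<close>, and this extra one contradicts the two bounds on
      \<open>?P\<close> and \<open>?P'\<close>.\<close>
    have "Suc (card (A \<union> A')) = card (insert x (A \<union> A'))"
      using A A' by simp
    also have "\<dots> \<le> card (\<Union>(E ` insert x (A \<union> A')))"
      using A A' x by (intro hall) auto
    also have "\<dots> \<le> card (?P \<union> ?P')"
      using finP \<open>y \<noteq> y'\<close> by (intro card_mono) auto
    finally have "Suc (card (A \<union> A')) \<le> card (?P \<union> ?P')" .
    moreover have "card (A \<inter> A') \<le> card (?P \<inter> ?P')"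
      using A A' finP by (intro order_trans[OF hall] card_mono) auto
    moreover have "card (?P \<union> ?P') + card (?P \<inter> ?P') = card ?P + card ?P'"
      using card_Un_Int[OF finP] by simp
    moreover have "card (A \<union> A') + card (A \<inter> A') = card A + card A'"
      using card_Un_Int[OF A(2) A'(2)] by simp
    ultimately show False using A(4) A'(4) by linarith
  qed
  \<comment> \<open>By Hall's condition and \<open>uniq\<close> each \<open>E i\<close> is a
    singleton, so the choice is forced. Two vertices with the same singleton would violate Hall's
    condition as a pair.\<close>
  have "E i \<noteq> {}" if "i \<in> I" for i
    using hall[of "{i}"] that by auto
  then have f: "(SOME y. y \<in> E i) \<in> E i" if "i \<in> I" for i
    using that by (simp add: some_in_eq)
  have "inj_on (\<lambda>i. SOME y. y \<in> E i) I"
  proof (rule inj_onI, rule ccontr)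
    fix i i' assume i: "i \<in> I" "i' \<in> I" "(SOME y. y \<in> E i) = (SOME y. y \<in> E i')" "i \<noteq> i'"
    have "E i = {SOME y. y \<in> E i}" "E i' = {SOME y. y \<in> E i}"
      using f[of i] f[of i'] i uniq by (metis empty_iff insertI1 insert_absorb is_singletonI' is_singleton_the_elem singletonD)+
    then have "\<Union>(E ` {i, i'}) = {SOME y. y \<in> E i}" by auto
    then show False using hall[of "{i, i'}"] i by simp
  qed
  with f show ?thesis by blast
qed

text \<open>Zorn's lemma on the sets \<open>X\<close> of edges that can be deleted without
  destroying Hall's condition: a maximal one leaves a graph \<open>D X\<close> that is edge-minimal,
  as \<open>marriage_minimal\<close> requires.\<close>

lemma marriage_locally_finite:
  assumes fin: "\<And>i. i \<in> I \<Longrightarrow> finite (E i)"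
    and hall: "\<And>A. A \<subseteq> I \<Longrightarrow> finite A \<Longrightarrow> card A \<le> card (\<Union>(E ` A))"
  shows "\<exists>f. inj_on f I \<and> (\<forall>i\<in>I. f i \<in> E i)"
proof -
  define D where "D X i = {y \<in> E i. (i, y) \<notin> X}" for X i
  define \<A> where "\<A> = {X. X \<subseteq> Sigma I E \<and> (\<forall>A. A \<subseteq> I \<and> finite A \<longrightarrow> card A \<le> card (\<Union>(D X ` A)))}"
  have "D {} = E" by (auto simp: D_def)
  then have "{} \<in> \<A>" using hall by (simp add: \<A>_def)
  moreover have "\<Union>\<C> \<in> \<A>" if ne: "\<C> \<noteq> {}" and ch: "subset.chain \<A> \<C>" for \<C>
  proof -
    have sub: "\<C> \<subseteq> \<A>" using ch by (simp add: subset.chain_def)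
    have "card A \<le> card (\<Union>(D (\<Union>\<C>) ` A))" if A: "A \<subseteq> I" "finite A" for A
    proof -
      \<comment> \<open>Hall's condition at a finite \<open>A\<close> involves only the finitely
        many edges leaving \<open>A\<close>, so one member of the chain already deletes all of those
        that the union deletes.\<close>
      have "finite (Sigma A E)" using A fin by blast
      then have "finite (\<Union>\<C> \<inter> Sigma A E)" by blast
      then obtain X where X: "X \<in> \<C>" "\<Union>\<C> \<inter> Sigma A E \<subseteq> X"
        using finite_subset_Union_chain[OF _ _ ne ch] by (metis Int_lower1)
      then have "D (\<Union>\<C>) i = D X i" if "i \<in> A" for i
        using that by (auto simp: D_def)
      then have "D (\<Union>\<C>) ` A = D X ` A" by (rule image_cong[OF refl])
      then show ?thesis using X sub A by (auto simp: \<A>_def)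
    qed
    then show ?thesis using sub by (auto simp: \<A>_def)
  qed
  ultimately obtain T where T: "T \<in> \<A>" and max: "\<And>X. X \<in> \<A> \<Longrightarrow> T \<subseteq> X \<Longrightarrow> X = T"
    using subset_Zorn_nonempty[of \<A>] by blast
  have "\<exists>f. inj_on f I \<and> (\<forall>i\<in>I. f i \<in> D T i)"
  proof (rule marriage_minimal)
    show "finite (D T i)" if "i \<in> I" for i
      using fin[OF that] by (simp add: D_def)
    show "card A \<le> card (\<Union>(D T ` A))" if "A \<subseteq> I" "finite A" for A
      using T that by (simp add: \<A>_def)
    show "\<exists>A. A \<subseteq> I \<and> finite A \<and> card (\<Union>(((D T)(x := D T x - {y})) ` A)) < card A"
      if "x \<in> I" "y \<in> D T x" for x y
    proof -
      have "insert (x, y) T \<notin> \<A>"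
        using max[of "insert (x, y) T"] that by (auto simp: D_def)
      then have "\<exists>A. A \<subseteq> I \<and> finite A \<and> card (\<Union>(D (insert (x, y) T) ` A)) < card A"
        using T that by (auto simp: \<A>_def D_def not_le)
      moreover have "D (insert (x, y) T) = (D T)(x := D T x - {y})"
        by (auto simp: D_def fun_eq_iff)
      ultimately show ?thesis by simp
    qed
  qed
  then show ?thesis by (auto simp: D_def)
qed

section \<open>From families of intervals to multisets\<close>

text \<open>The elements of each fibre of \<open>J\<close> are numbered; finiteness of the fibres
  makes \<open>card\<close> count them. This identifies the index set of a decomposition with its
  barcode.\<close>

lemma bij_betw_copies:
  assumes "\<And>y. finite {i \<in> I. J i = y}"
  shows "\<exists>\<tau>. bij_betw \<tau> I (copies (\<lambda>y. card {i \<in> I. J i = y})) \<and> (\<forall>i. fst (\<tau> i) = J i)"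
proof -
  define e where "e y = (SOME e. bij_betw e {i \<in> I. J i = y} {0..<card {i \<in> I. J i = y}})" for y
  have e: "bij_betw (e y) {i \<in> I. J i = y} {0..<card {i \<in> I. J i = y}}" for y
    unfolding e_def by (rule someI_ex[OF ex_bij_betw_finite_nat[OF assms]])
  have "bij_betw (\<lambda>i. (J i, e (J i) i)) I (copies (\<lambda>y. card {i \<in> I. J i = y}))"
  proof (rule bij_betw_imageI)
    show "inj_on (\<lambda>i. (J i, e (J i) i)) I"
      using e by (auto simp: inj_on_def bij_betw_def)
    show "(\<lambda>i. (J i, e (J i) i)) ` I = copies (\<lambda>y. card {i \<in> I. J i = y})"
    proof (intro equalityI subsetI)
      fix p assume "p \<in> copies (\<lambda>y. card {i \<in> I. J i = y})"
      then have "snd p \<in> e (fst p) ` {i \<in> I. J i = fst p}"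
        using e[of "fst p"] by (auto simp: copies_def bij_betw_def)
      then show "p \<in> (\<lambda>i. (J i, e (J i) i)) ` I" by (cases p) auto
    next
      fix p assume "p \<in> (\<lambda>i. (J i, e (J i) i)) ` I"
      then obtain i where i: "i \<in> I" "p = (J i, e (J i) i)" by blast
      then have "e (J i) i \<in> {0..<card {i' \<in> I. J i' = J i}}"
        using e[of "J i"] by (auto simp: bij_betw_def)
      then show "p \<in> copies (\<lambda>y. card {i \<in> I. J i = y})"
        using i by (simp add: copies_def)
    qed
  qed
  then show ?thesis by fastforce
qed

section \<open>Linear algebra\<close>

text \<open>Gaussian elimination by induction on the equations: an equation \<open>b\<close> with a
  nonzero coefficient \<open>F k b\<close> is solved for the unknown \<open>c k\<close> and
  substituted into the others, which leaves one equation and one unknown less.\<close>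

lemma (in field) underdetermined_system:
  assumes "finite B" "finite A" "card B < card A"
    and "\<And>i j. i \<in> A \<Longrightarrow> j \<in> B \<Longrightarrow> F i j \<in> carrier R"
  shows "\<exists>c. (\<forall>i\<in>A. c i \<in> carrier R) \<and> (\<exists>i\<in>A. c i \<noteq> \<zero>) \<and>
    (\<forall>j\<in>B. (\<Oplus>i\<in>A. c i \<otimes> F i j) = \<zero>)"
  using assms
proof (induction B arbitrary: A F rule: finite_induct)
  case empty
  then show ?case by (intro exI[of _ "\<lambda>_. \<one>"]) (auto simp: card_gt_0_iff)
next
  case (insert b B)
  note Fc = insert.prems(3)
  show ?case
  proof (cases "\<forall>i\<in>A. F i b = \<zero>")
    case True
    obtain c where c: "\<forall>i\<in>A. c i \<in> carrier R" "\<exists>i\<in>A. c i \<noteq> \<zero>"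
      "\<forall>j\<in>B. (\<Oplus>i\<in>A. c i \<otimes> F i j) = \<zero>"
      using insert.IH[of A F] insert.prems insert.hyps by auto
    have "(\<Oplus>i\<in>A. c i \<otimes> F i b) = (\<Oplus>i\<in>A. \<zero>)"
      using c(1) True by (intro finsum_cong') auto
    then show ?thesis using c by auto
  next
    case False
    then obtain k where k: "k \<in> A" "F k b \<noteq> \<zero>" by blast
    have q: "inv (F k b) \<in> carrier R" "F k b \<otimes> inv (F k b) = \<one>" "inv (F k b) \<otimes> F k b = \<one>"
      using k Fc by (auto simp: field_Units)
    \<comment> \<open>The factor with which column \<open>b\<close> is added to column
      \<open>j\<close> in order to clear row \<open>k\<close>.\<close>
    define d where "d j = \<ominus> (inv (F k b) \<otimes> F k j)" for j
    have d: "d j \<in> carrier R" if "j \<in> insert b B" for j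
      using that q k Fc by (simp add: d_def)
    let ?A = "A - {k}"
    let ?F = "\<lambda>i j. F i j \<oplus> F i b \<otimes> d j"
    have "card B < card ?A" using insert k by simp
    then obtain c where c: "\<forall>i\<in>?A. c i \<in> carrier R" "\<exists>i\<in>?A. c i \<noteq> \<zero>"
      "\<forall>j\<in>B. (\<Oplus>i\<in>?A. c i \<otimes> ?F i j) = \<zero>"
      using insert.IH[of ?A ?F] insert.prems d by auto
    define s where "s = (\<Oplus>i\<in>?A. c i \<otimes> F i b)"
    have s: "s \<in> carrier R"
      unfolding s_def using c(1) Fc by (intro finsum_closed) auto
    \<comment> \<open>The value at \<open>k\<close> is the one that equation \<open>b\<close>
      forces.\<close>
    define c' where "c' i = (if i = k then \<ominus> (s \<otimes> inv (F k b)) else c i)" for i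
    have c'c: "\<forall>i\<in>A. c' i \<in> carrier R" using c(1) s q by (auto simp: c'_def)
    have sum: "(\<Oplus>i\<in>A. c' i \<otimes> F i j) = \<ominus> (s \<otimes> inv (F k b)) \<otimes> F k j \<oplus> (\<Oplus>i\<in>?A. c i \<otimes> F i j)"
      if j: "j \<in> insert b B" for j
    proof -
      have "(\<Oplus>i\<in>insert k ?A. c' i \<otimes> F i j) = c' k \<otimes> F k j \<oplus> (\<Oplus>i\<in>?A. c' i \<otimes> F i j)"
        using insert.prems(1) k c'c j Fc by (intro finsum_insert) auto
      moreover have "insert k ?A = A" using k by auto
      moreover have "(\<Oplus>i\<in>?A. c' i \<otimes> F i j) = (\<Oplus>i\<in>?A. c i \<otimes> F i j)"
        using c(1) Fc j by (intro finsum_cong') (auto simp: c'_def)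
      ultimately show ?thesis by (simp add: c'_def)
    qed
    have "(\<Oplus>i\<in>A. c' i \<otimes> F i j) = \<zero>" if j: "j \<in> insert b B" for j
    proof (cases "j = b")
      case True
      have "(\<Oplus>i\<in>A. c' i \<otimes> F i b) = \<ominus> (s \<otimes> inv (F k b)) \<otimes> F k b \<oplus> s"
        using sum[of b] by (simp add: s_def)
      also have "\<dots> = \<ominus> (s \<otimes> (inv (F k b) \<otimes> F k b)) \<oplus> s"
        using s q(1) k Fc by (simp add: l_minus m_assoc)
      also have "\<dots> = \<zero>" using s q by (simp add: l_neg)
      finally show ?thesis using True by simp
    next
      case False
      then have j: "j \<in> B" using that by simp
      have "\<zero> = (\<Oplus>i\<in>?A. c i \<otimes> ?F i j)" using c(3) j by simp
      also have "\<dots> = (\<Oplus>i\<in>?A. c i \<otimes> F i j \<oplus> c i \<otimes> F i b \<otimes> d j)"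
        using c(1) Fc d j by (intro finsum_cong') (auto simp: r_distr m_assoc)
      also have "\<dots> = (\<Oplus>i\<in>?A. c i \<otimes> F i j) \<oplus> (\<Oplus>i\<in>?A. c i \<otimes> F i b \<otimes> d j)"
        using c(1) Fc d j by (intro finsum_addf) auto
      also have "(\<Oplus>i\<in>?A. c i \<otimes> F i b \<otimes> d j) = s \<otimes> d j"
        unfolding s_def using c(1) Fc d j insert.prems(1) by (intro finsum_ldistr[symmetric]) auto
      also have "s \<otimes> d j = \<ominus> (s \<otimes> inv (F k b)) \<otimes> F k j"
        using s q(1) k Fc j by (simp add: d_def l_minus r_minus m_assoc)
      finally have "\<zero> = (\<Oplus>i\<in>?A. c i \<otimes> F i j) \<oplus> \<ominus> (s \<otimes> inv (F k b)) \<otimes> F k j" .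
      moreover have "(\<Oplus>i\<in>?A. c i \<otimes> F i j) \<in> carrier R"
        using c(1) Fc j by (intro finsum_closed) auto
      ultimately show ?thesis
        using sum[of j] j s q(1) k Fc by (simp add: a_comm)
    qed
    moreover have "\<exists>i\<in>A. c' i \<noteq> \<zero>" using c(2) by (auto simp: c'_def)
    ultimately show ?thesis using c'c by blast
  qed
qed

lemma (in semiring) finsum_swap:
  assumes "finite A" "finite B" "\<And>i j. i \<in> A \<Longrightarrow> j \<in> B \<Longrightarrow> f i j \<in> carrier R"
  shows "(\<Oplus>i\<in>A. \<Oplus>j\<in>B. f i j) = (\<Oplus>j\<in>B. \<Oplus>i\<in>A. f i j)"
  using assms(1,3)
proof (induction A rule: finite_induct)
  case empty
  then show ?case by simp
next
  case (insert a A)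
  have "(\<Oplus>j\<in>B. \<Oplus>i\<in>insert a A. f i j) = (\<Oplus>j\<in>B. f a j \<oplus> (\<Oplus>i\<in>A. f i j))"
    using insert by (intro finsum_cong') (auto intro!: finsum_closed)
  also have "\<dots> = (\<Oplus>j\<in>B. f a j) \<oplus> (\<Oplus>j\<in>B. \<Oplus>i\<in>A. f i j)"
    using insert by (intro finsum_addf) (auto intro!: finsum_closed)
  also have "\<dots> = (\<Oplus>i\<in>insert a A. \<Oplus>j\<in>B. f i j)"
    using insert by (subst finsum_insert) (auto intro!: finsum_closed)
  finally show ?case ..
qed

text \<open>Otherwise the rows of \<open>F\<close> satisfy a nontrivial relation \<open>c\<close>.
  Let \<open>m\<close> maximize \<open>\<alpha>\<close> on the support of \<open>c\<close>.
  Multiplying the relation by the column of \<open>G\<close> at \<open>m\<close> meets, on the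
  support, only entries with \<open>\<alpha> i \<le> \<alpha> m\<close>, which are known, and gives
  \<open>c m = \<zero>\<close>.\<close>

lemma (in field) card_le_of_unitriangular_product:
  fixes \<alpha> :: "'i \<Rightarrow> real"
  assumes fin: "finite A" "finite B"
    and F: "\<And>i j. i \<in> A \<Longrightarrow> j \<in> B \<Longrightarrow> F i j \<in> carrier R"
    and G: "\<And>i j. i \<in> A \<Longrightarrow> j \<in> B \<Longrightarrow> G j i \<in> carrier R"
    and FG: "\<And>i i'. i \<in> A \<Longrightarrow> i' \<in> A \<Longrightarrow> \<alpha> i \<le> \<alpha> i' \<Longrightarrow>
      (\<Oplus>j\<in>B. F i j \<otimes> G j i') = (if i = i' then \<one> else \<zero>)"
  shows "card A \<le> card B"
proof (rule ccontr)
  assume "\<not> card A \<le> card B"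
  then obtain c where c: "\<forall>i\<in>A. c i \<in> carrier R" "\<exists>i\<in>A. c i \<noteq> \<zero>"
      "\<forall>j\<in>B. (\<Oplus>i\<in>A. c i \<otimes> F i j) = \<zero>"
    using underdetermined_system[OF fin(2,1), of F] F by (auto simp: not_le)
  define S where "S = {i \<in> A. c i \<noteq> \<zero>}"
  have "finite (\<alpha> ` S)" "\<alpha> ` S \<noteq> {}" using fin c(2) by (auto simp: S_def)
  then obtain m where m: "m \<in> S" "\<And>i. i \<in> S \<Longrightarrow> \<alpha> i \<le> \<alpha> m"
    using Max_in[of "\<alpha> ` S"] Max_ge[of "\<alpha> ` S"] by fastforce
  then have mA: "m \<in> A" by (simp add: S_def)
  have "(\<Oplus>j\<in>B. (\<Oplus>i\<in>A. c i \<otimes> F i j) \<otimes> G j m) = (\<Oplus>j\<in>B. \<zero>)"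
    using c(3) G[OF mA] by (intro finsum_cong') auto
  then have "\<zero> = (\<Oplus>j\<in>B. (\<Oplus>i\<in>A. c i \<otimes> F i j) \<otimes> G j m)" by simp
  also have "\<dots> = (\<Oplus>j\<in>B. \<Oplus>i\<in>A. c i \<otimes> F i j \<otimes> G j m)"
    using c(1) F G mA fin by (intro finsum_cong') (auto intro!: finsum_closed finsum_ldistr)
  also have "\<dots> = (\<Oplus>i\<in>A. \<Oplus>j\<in>B. c i \<otimes> F i j \<otimes> G j m)"
    using c(1) F G mA fin by (intro finsum_swap[symmetric]) auto
  also have "\<dots> = (\<Oplus>i\<in>A. if i = m then c i else \<zero>)"
  proof (intro finsum_cong' refl)
    fix i assume i: "i \<in> A"
    have "(\<Oplus>j\<in>B. c i \<otimes> F i j \<otimes> G j m) = (\<Oplus>j\<in>B. c i \<otimes> (F i j \<otimes> G j m))"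
      using c(1) F G mA i by (intro finsum_cong') (auto simp: m_assoc)
    also have "\<dots> = c i \<otimes> (\<Oplus>j\<in>B. F i j \<otimes> G j m)"
      using c(1) F G mA i fin by (intro finsum_rdistr[symmetric]) auto
    \<comment> \<open>Off the support of \<open>c\<close> the entry of the product may be unknown,
      but its coefficient is zero.\<close>
    also have "\<dots> = (if i = m then c i else \<zero>)"
    proof (cases "i \<in> S")
      case True
      then show ?thesis using FG[OF i mA m(2)] c(1) i mA by simp
    next
      case False
      have "(\<Oplus>j\<in>B. F i j \<otimes> G j m) \<in> carrier R"
        using F G mA i by (intro finsum_closed) auto
      with False show ?thesis using i m by (auto simp: S_def)
    qed
    finally show "(\<Oplus>j\<in>B. c i \<otimes> F i j \<otimes> G j m) = (if i = m then c i else \<zero>)" .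
  qed (use c in auto)
  also have "\<dots> = c m"
    using finsum_singleton[OF mA fin(1), of c] c(1) by (simp add: eq_commute)
  finally show False using m by (simp add: S_def)
qed

section \<open>Morphisms and interleavings\<close>

lemma linear_mapI:
  assumes "vectorspace K V" "vectorspace K W"
    and "\<And>x. x \<in> carrier V \<Longrightarrow> T x \<in> carrier W"
    and "\<And>x y. x \<in> carrier V \<Longrightarrow> y \<in> carrier V \<Longrightarrow> T (x \<oplus>\<^bsub>V\<^esub> y) = T x \<oplus>\<^bsub>W\<^esub> T y"
    and "\<And>c x. c \<in> carrier K \<Longrightarrow> x \<in> carrier V \<Longrightarrow> T (c \<odot>\<^bsub>V\<^esub> x) = c \<odot>\<^bsub>W\<^esub> T x"
  shows "linear_map K V W T"
  using assms by (simp add: linear_map_def mod_hom_def mod_hom_axioms_def module_hom_def vectorspace_def)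

lemma linear_mapD:
  assumes "linear_map K V W T"
  shows "vectorspace K V" "vectorspace K W"
    and "x \<in> carrier V \<Longrightarrow> T x \<in> carrier W"
    and "x \<in> carrier V \<Longrightarrow> y \<in> carrier V \<Longrightarrow> T (x \<oplus>\<^bsub>V\<^esub> y) = T x \<oplus>\<^bsub>W\<^esub> T y"
    and "c \<in> carrier K \<Longrightarrow> x \<in> carrier V \<Longrightarrow> T (c \<odot>\<^bsub>V\<^esub> x) = c \<odot>\<^bsub>W\<^esub> T x"
    and "T \<zero>\<^bsub>V\<^esub> = \<zero>\<^bsub>W\<^esub>"
  using assms linear_map.T0_is_0[OF assms]
  by (auto simp: linear_map_def mod_hom_def mod_hom_axioms_def module_hom_def)

lemma linear_map_comp:
  assumes "linear_map K U V S" "linear_map K V W T"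
  shows "linear_map K U W (T \<circ> S)"
  by (rule linear_mapI) (simp_all add: linear_mapD[OF assms(1)] linear_mapD[OF assms(2)])

lemma pm_hom_linear: "pm_hom K M N f \<Longrightarrow> linear_map K (obj M p) (obj N p) (f p)"
  by (simp add: pm_hom_def)

lemma pm_hom_natural:
  "pm_hom K M N f \<Longrightarrow> p \<le> q \<Longrightarrow> x \<in> carrier (obj M p) \<Longrightarrow> f q (imap M p q x) = imap N p q (f p x)"
  by (simp add: pm_hom_def)

lemma pm_hom_comp:
  assumes "pm_hom K L M f" "pm_hom K M N g"
  shows "pm_hom K L N (pm_comp g f)"
  unfolding pm_hom_def
proof (intro conjI allI impI ballI)
  show "linear_map K (obj L p) (obj N p) (pm_comp g f p)" for p
    unfolding pm_comp_def by (rule linear_map_comp) (rule pm_hom_linear assms)+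
  show "pm_comp g f q (imap L p q x) = imap N p q (pm_comp g f p x)"
    if "p \<le> q" "x \<in> carrier (obj L p)" for p q x
    using that pm_hom_natural[OF assms(1)] pm_hom_natural[OF assms(2)]
      linear_mapD(3)[OF pm_hom_linear[OF assms(1)]] by (simp add: pm_comp_def)
qed

lemma pm_hom_shift:
  assumes "pm_hom K M N f"
  shows "pm_hom K (pm_shift \<epsilon> M) (pm_shift \<epsilon> N) (hom_shift \<epsilon> f)"
  using assms by (auto simp: pm_hom_def pm_shift_def hom_shift_def less_eq_prod_def)

lemma pm_isomorphic_sym: "pm_isomorphic K M N \<Longrightarrow> pm_isomorphic K N M"
  unfolding pm_isomorphic_def by blast

lemma interleaved_sym: "interleaved K \<epsilon> M N \<Longrightarrow> interleaved K \<epsilon> N M"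
  unfolding interleaved_def by blast

text \<open>Serves the uniqueness of the barcode: any two decompositions of \<open>M\<close> become
  0-interleaved.\<close>

lemma interleaved_refl:
  assumes "persistence_module K M"
  shows "interleaved K 0 M M"
proof -
  interpret persistence_module K M by fact
  have 0: "p + (0, 0) = p" for p :: "real \<times> real" by (simp add: prod_eq_iff)
  have "pm_hom K M (pm_shift 0 M) (\<lambda>p x. x)"
    using vectorspace_obj by (auto simp: pm_hom_def pm_shift_def 0 intro!: linear_mapI)
  moreover have "pm_eq M (pm_comp (hom_shift 0 (\<lambda>p x. x)) (\<lambda>p x. x)) (trans_hom (2 * 0) M)"
    by (simp add: pm_eq_def pm_comp_def hom_shift_def trans_hom_def 0 imap_id)
  ultimately show ?thesis unfolding interleaved_def by blast
qed

text \<open>The interleaving is conjugated with the isomorphism. The triangle at \<open>M'\<close>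
  needs naturality of \<open>u\<close> to move it past the internal map; in the triangle at
  \<open>N\<close> the inner factors \<open>v\<close> and \<open>u\<close> cancel.\<close>

lemma interleaved_cong_isomorphic_left:
  assumes "0 \<le> \<epsilon>" and "pm_isomorphic K M M'" and "interleaved K \<epsilon> M N"
  shows "interleaved K \<epsilon> M' N"
proof -
  obtain u v where u: "pm_hom K M M' u" and v: "pm_hom K M' M v"
    and vu: "pm_eq M (pm_comp v u) (\<lambda>p x. x)" and uv: "pm_eq M' (pm_comp u v) (\<lambda>p x. x)"
    using assms(2) unfolding pm_isomorphic_def by blast
  obtain f g where f: "pm_hom K M (pm_shift \<epsilon> N) f" and g: "pm_hom K N (pm_shift \<epsilon> M) g"
    and gf: "pm_eq M (pm_comp (hom_shift \<epsilon> g) f) (trans_hom (2 * \<epsilon>) M)"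
    and fg: "pm_eq N (pm_comp (hom_shift \<epsilon> f) g) (trans_hom (2 * \<epsilon>) N)"
    using assms(3) unfolding interleaved_def by blast
  have vc: "v p x \<in> carrier (obj M p)" if "x \<in> carrier (obj M' p)" for p x
    using linear_mapD(3)[OF pm_hom_linear[OF v]] that .
  have gc: "g p x \<in> carrier (obj M (p + (\<epsilon>, \<epsilon>)))" if "x \<in> carrier (obj N p)" for p x
    using linear_mapD(3)[OF pm_hom_linear[OF g]] that by (simp add: pm_shift_def)
  have e: "p + (\<epsilon>, \<epsilon>) + (\<epsilon>, \<epsilon>) = p + (2 * \<epsilon>, 2 * \<epsilon>)" for p :: "real \<times> real"
    by (simp add: prod_eq_iff)
  have le: "p \<le> p + (2 * \<epsilon>, 2 * \<epsilon>)" for p :: "real \<times> real"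
    using assms(1) by (simp add: less_eq_prod_def)
  let ?f = "pm_comp f v" and ?g = "pm_comp (hom_shift \<epsilon> u) g"
  have "pm_hom K M' (pm_shift \<epsilon> N) ?f" by (rule pm_hom_comp[OF v f])
  moreover have "pm_hom K N (pm_shift \<epsilon> M') ?g" by (rule pm_hom_comp[OF g pm_hom_shift[OF u]])
  moreover have "pm_eq M' (pm_comp (hom_shift \<epsilon> ?g) ?f) (trans_hom (2 * \<epsilon>) M')"
    unfolding pm_eq_def
  proof (intro allI ballI)
    fix p x assume x: "x \<in> carrier (obj M' p)"
    have "pm_comp (hom_shift \<epsilon> ?g) ?f p x = u (p + (2 * \<epsilon>, 2 * \<epsilon>)) (g (p + (\<epsilon>, \<epsilon>)) (f p (v p x)))"
      by (simp add: pm_comp_def hom_shift_def e)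
    also have "g (p + (\<epsilon>, \<epsilon>)) (f p (v p x)) = imap M p (p + (2 * \<epsilon>, 2 * \<epsilon>)) (v p x)"
      using gf vc[OF x] by (simp add: pm_eq_def pm_comp_def hom_shift_def trans_hom_def)
    also have "u (p + (2 * \<epsilon>, 2 * \<epsilon>)) \<dots> = imap M' p (p + (2 * \<epsilon>, 2 * \<epsilon>)) (u p (v p x))"
      by (rule pm_hom_natural[OF u le vc[OF x]])
    also have "u p (v p x) = x"
      using uv x by (simp add: pm_eq_def pm_comp_def)
    finally show "pm_comp (hom_shift \<epsilon> ?g) ?f p x = trans_hom (2 * \<epsilon>) M' p x"
      by (simp add: trans_hom_def)
  qed
  moreover have "pm_eq N (pm_comp (hom_shift \<epsilon> ?f) ?g) (trans_hom (2 * \<epsilon>) N)"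
    unfolding pm_eq_def
  proof (intro allI ballI)
    fix p x assume x: "x \<in> carrier (obj N p)"
    have "v (p + (\<epsilon>, \<epsilon>)) (u (p + (\<epsilon>, \<epsilon>)) (g p x)) = g p x"
      using vu gc[OF x] by (simp add: pm_eq_def pm_comp_def)
    then have "pm_comp (hom_shift \<epsilon> ?f) ?g p x = f (p + (\<epsilon>, \<epsilon>)) (g p x)"
      by (simp add: pm_comp_def hom_shift_def)
    then show "pm_comp (hom_shift \<epsilon> ?f) ?g p x = trans_hom (2 * \<epsilon>) N p x"
      using fg x by (simp add: pm_eq_def pm_comp_def hom_shift_def)
  qed
  ultimately show ?thesis unfolding interleaved_def by blast
qed

lemma interleaved_cong_isomorphic:
  assumes "0 \<le> \<epsilon>" "pm_isomorphic K M M'" "pm_isomorphic K N N'" "interleaved K \<epsilon> M N"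
  shows "interleaved K \<epsilon> M' N'"
  using assms by (blast intro: interleaved_cong_isomorphic_left interleaved_sym)

section \<open>Upsets\<close>

text \<open>Distance at most \<open>\<epsilon>\<close> in the maximum norm, written with the order
  because each half is the condition for a nonzero morphism in one direction between shifted
  upsets.\<close>

definition close :: "real \<Rightarrow> real \<times> real \<Rightarrow> real \<times> real \<Rightarrow> bool" where
  "close \<epsilon> p q \<longleftrightarrow> q \<le> p + (\<epsilon>, \<epsilon>) \<and> p \<le> q + (\<epsilon>, \<epsilon>)"

lemma close_sym: "close \<epsilon> p q \<longleftrightarrow> close \<epsilon> q p"
  by (auto simp: close_def)

lemma close_0_iff: "close 0 p q \<longleftrightarrow> p = q"
  by (auto simp: close_def less_eq_prod_def prod_eq_iff)

text \<open>The only place where the poset being two-dimensional matters.\<close>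

lemma close_either_end:
  assumes "q \<le> p + (\<epsilon>, \<epsilon>)" "p' \<le> q + (\<epsilon>, \<epsilon>)" "fst p + snd p \<le> fst p' + snd p'"
  shows "close \<epsilon> p q \<or> close \<epsilon> p' q"
  \<comment> \<open>If both fail, \<open>p\<close> exceeds \<open>q\<close> by more than
    \<open>\<epsilon>\<close> in one coordinate and \<open>q\<close> exceeds \<open>p'\<close> by
    more than \<open>\<epsilon>\<close> in one. If these coordinates differ, \<open>p\<close> is
    larger than \<open>p'\<close> in both; if they agree, \<open>p\<close> is ahead of
    \<open>p'\<close> by more than \<open>2 * \<epsilon>\<close> there and behind by at most
    \<open>2 * \<epsilon>\<close> in the other. Either way the coordinate sums contradict the
    assumption.\<close>
  using assms by (auto simp: close_def less_eq_prod_def)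

lemma upset_eq_iff: "{q. p \<le> q} = {q. p' \<le> q} \<longleftrightarrow> p = (p' :: 'a :: order)"
  by (auto simp: set_eq_iff intro: antisym)

text \<open>Forces a matching between barcodes of free modules to cover every bar.\<close>

lemma interval_not_trivial_upset:
  assumes "field K" "0 \<le> \<epsilon>"
  shows "\<not> interval_trivial K \<epsilon> {q. p \<le> q}"
proof -
  interpret field K by fact
  have "p \<le> p + (\<epsilon>, \<epsilon>)" using assms(2) by (simp add: less_eq_prod_def)
  then show ?thesis
    by (auto simp: interval_trivial_def pm_eq_def interval_pm_def trans_hom_def
        intro!: exI[of _ p] bexI[of _ "\<one>\<^bsub>K\<^esub>"])
qed

text \<open>If \<open>b\<close> is not below \<open>a + (\<epsilon>, \<epsilon>)\<close>, the target
  of \<open>f a\<close> is zero, whereas the composite with \<open>g\<close> must fix the generator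
  at \<open>a\<close>. Conversely, the identity on scalars serves in both directions.\<close>

lemma intervals_interleaved_upset_iff:
  assumes K: "field K" and e: "0 \<le> \<epsilon>"
  shows "intervals_interleaved K \<epsilon> {q. a \<le> q} {q. b \<le> q} \<longleftrightarrow> close \<epsilon> a b"
proof
  interpret field K by fact
  have le: "b \<le> a + (\<epsilon>, \<epsilon>)" if "interleaved K \<epsilon> (interval_pm K {q. a \<le> q}) (interval_pm K {q. b \<le> q})"
    for a b
  proof (rule ccontr)
    assume nle: "\<not> b \<le> a + (\<epsilon>, \<epsilon>)"
    let ?M = "interval_pm K {q. a \<le> q}" and ?N = "interval_pm K {q. b \<le> q}"
    obtain f g where f: "pm_hom K ?M (pm_shift \<epsilon> ?N) f" and g: "pm_hom K ?N (pm_shift \<epsilon> ?M) g"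
      and gf: "pm_eq ?M (pm_comp (hom_shift \<epsilon> g) f) (trans_hom (2 * \<epsilon>) ?M)"
      using \<open>interleaved K \<epsilon> ?M ?N\<close> unfolding interleaved_def by blast
    have "f a \<one>\<^bsub>K\<^esub> = \<zero>\<^bsub>K\<^esub>"
      using linear_mapD(3)[OF pm_hom_linear[OF f], of "\<one>\<^bsub>K\<^esub>" a] nle
      by (simp add: pm_shift_def interval_pm_def)
    moreover have "g (a + (\<epsilon>, \<epsilon>)) \<zero>\<^bsub>K\<^esub> = \<zero>\<^bsub>K\<^esub>"
      using linear_mapD(6)[OF pm_hom_linear[OF g], of "a + (\<epsilon>, \<epsilon>)"]
      by (simp add: pm_shift_def interval_pm_def)
    moreover have "a \<le> a + (2 * \<epsilon>, 2 * \<epsilon>)" using e by (simp add: less_eq_prod_def)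
    then have "g (a + (\<epsilon>, \<epsilon>)) (f a \<one>\<^bsub>K\<^esub>) = \<one>\<^bsub>K\<^esub>"
      using gf[unfolded pm_eq_def, rule_format, of "\<one>\<^bsub>K\<^esub>" a]
      by (simp add: pm_comp_def hom_shift_def trans_hom_def interval_pm_def)
    ultimately show False by simp
  qed
  then show "close \<epsilon> a b" if "intervals_interleaved K \<epsilon> {q. a \<le> q} {q. b \<le> q}"
    using that interleaved_sym unfolding intervals_interleaved_def close_def by metis
next
  interpret field K by fact
  assume ab: "close \<epsilon> a b"
  have hom: "pm_hom K (interval_pm K {q. a \<le> q}) (pm_shift \<epsilon> (interval_pm K {q. b \<le> q})) (\<lambda>p x. x)"
    if "b \<le> a + (\<epsilon>, \<epsilon>)" for a b
  proof -
    have "b \<le> p + (\<epsilon>, \<epsilon>)" if "a \<le> p" for p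
      using \<open>b \<le> _\<close> that by (auto simp: less_eq_prod_def)
    moreover have "a \<le> q" if "a \<le> p" "p \<le> q" for p q using that by (rule order_trans)
    ultimately show ?thesis
      unfolding pm_hom_def pm_shift_def
      by (auto intro!: linear_mapI vectorspace_interval_pm[OF K])
        (auto simp: interval_pm_def split: if_splits)
  qed
  have eq: "pm_eq (interval_pm K {q. a \<le> q}) (pm_comp (hom_shift \<epsilon> (\<lambda>p x. x)) (\<lambda>p x. x))
      (trans_hom (2 * \<epsilon>) (interval_pm K {q. a \<le> q}))" for a
  proof -
    have "a \<le> p + (2 * \<epsilon>, 2 * \<epsilon>)" if "a \<le> p" for p
      using that e by (auto simp: less_eq_prod_def)
    then show ?thesis
      by (auto simp: pm_eq_def pm_comp_def hom_shift_def trans_hom_def interval_pm_def)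
  qed
  show "intervals_interleaved K \<epsilon> {q. a \<le> q} {q. b \<le> q}"
    unfolding intervals_interleaved_def interleaved_def
    using hom eq ab unfolding close_def by blast
qed

section \<open>Sums of upsets\<close>

text \<open>Indexed by generators instead of upsets, so that the order of the plane applies to them
  directly.\<close>

definition free_sum ::
  "('k, 'r) ring_scheme \<Rightarrow> 'i set \<Rightarrow> ('i \<Rightarrow> real \<times> real) \<Rightarrow> ('k, 'i \<Rightarrow> 'k) persmod" where
  "free_sum K I a = pm_dsum I (\<lambda>i. interval_pm K {q. a i \<le> q})"

lemma persistence_module_free_sum: "field K \<Longrightarrow> persistence_module K (free_sum K I a)"
  unfolding free_sum_def
  by (intro persistence_module_pm_dsum persistence_module_interval_pm poset_interval_upset)

lemma carrier_free_sum:
  "x \<in> carrier (obj (free_sum K I a) p) \<longleftrightarrow>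
    x \<in> extensional I \<and> (\<forall>i\<in>I. x i \<in> (if a i \<le> p then carrier K else {\<zero>\<^bsub>K\<^esub>})) \<and>
    finite {i \<in> I. x i \<noteq> \<zero>\<^bsub>K\<^esub>}"
  by (auto simp: free_sum_def pm_dsum_def interval_pm_def PiE_def Pi_def)

lemma free_sum_simps:
  "\<zero>\<^bsub>obj (free_sum K I a) p\<^esub> = (\<lambda>i\<in>I. \<zero>\<^bsub>K\<^esub>)"
  "x \<oplus>\<^bsub>obj (free_sum K I a) p\<^esub> y = (\<lambda>i\<in>I. x i \<oplus>\<^bsub>K\<^esub> y i)"
  "c \<odot>\<^bsub>obj (free_sum K I a) p\<^esub> x = (\<lambda>i\<in>I. c \<otimes>\<^bsub>K\<^esub> x i)"
  "imap (free_sum K I a) p q x = (\<lambda>i\<in>I. if a i \<le> p \<and> a i \<le> q then x i else \<zero>\<^bsub>K\<^esub>)"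
  by (simp_all add: free_sum_def pm_dsum_def interval_pm_def)

text \<open>Generators are chosen for the indices in \<open>I\<close>. As \<open>pm_dsum\<close>
  reads the family only there, the two sums are literally equal.\<close>

lemma free_decompositionE:
  assumes "free_decomposition K M I J"
  obtains a where "\<And>i. i \<in> I \<Longrightarrow> J i = {q. a i \<le> q}" "pm_isomorphic K M (free_sum K I a)"
proof -
  obtain a where a: "\<forall>i\<in>I. J i = {q. a i \<le> q}"
    using assms unfolding free_decomposition_def by metis
  then have "pm_dsum I (\<lambda>i. interval_pm K (J i)) = free_sum K I a"
    unfolding free_sum_def pm_dsum_def
    by (auto intro!: ext simp: fun_eq_iff restrict_def PiE_def Pi_def extensional_def cong: conj_cong)
  with that a assms show thesis unfolding free_decomposition_def by simp
qed

section \<open>Coordinates and matrices of morphisms\<close>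

text \<open>The generator of summand \<open>i\<close>. One function represents it at every point
  above \<open>a i\<close>, because the internal maps between such points preserve it.\<close>

definition unit_at :: "('k, 'r) ring_scheme \<Rightarrow> 'i set \<Rightarrow> 'i \<Rightarrow> 'i \<Rightarrow> 'k" where
  "unit_at K I i = (\<lambda>j\<in>I. if j = i then \<one>\<^bsub>K\<^esub> else \<zero>\<^bsub>K\<^esub>)"

lemma unit_at_carrier:
  assumes "field K" "a i \<le> p"
  shows "unit_at K I i \<in> carrier (obj (free_sum K I a) p)"
proof -
  interpret field K by fact
  have "{j \<in> I. unit_at K I i j \<noteq> \<zero>\<^bsub>K\<^esub>} \<subseteq> {i}" by (auto simp: unit_at_def)
  then have "finite {j \<in> I. unit_at K I i j \<noteq> \<zero>\<^bsub>K\<^esub>}" by (rule finite_subset) simp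
  then show ?thesis using assms(2) unfolding carrier_free_sum by (auto simp: unit_at_def)
qed

text \<open>Expansion of \<open>x\<close> in the basis vectors that exist at \<open>p\<close>, by
  induction on a finite set \<open>S\<close> containing the support of \<open>x\<close>.\<close>

lemma linear_map_free_sum_coordinate:
  assumes K: "field K"
    and T: "linear_map K (obj (free_sum K I a) p) (obj (free_sum K I' b) q) T"
    and k: "k \<in> I'" and S: "finite S" "S \<subseteq> {i \<in> I. a i \<le> p}"
    and x: "x \<in> carrier (obj (free_sum K I a) p)" "\<And>i. i \<in> I \<Longrightarrow> i \<notin> S \<Longrightarrow> x i = \<zero>\<^bsub>K\<^esub>"
  shows "T x k = (\<Oplus>\<^bsub>K\<^esub>i\<in>S. x i \<otimes>\<^bsub>K\<^esub> T (unit_at K I i) k)"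
  using S x
proof (induction S arbitrary: x rule: finite_induct)
  case empty
  then have "x = \<zero>\<^bsub>obj (free_sum K I a) p\<^esub>"
    by (intro extensionalityI[of _ I]) (auto simp: free_sum_simps carrier_free_sum)
  then have "T x = \<zero>\<^bsub>obj (free_sum K I' b) q\<^esub>" using linear_mapD(6)[OF T] by simp
  then show ?case using k field.is_ring[OF K] by (simp add: free_sum_simps abelian_monoid.finsum_empty ring.is_abelian_group abelian_group.axioms(1))
next
  case (insert s S)
  interpret field K by fact
  have s: "s \<in> I" "a s \<le> p" using insert.prems by auto
  have xs: "x i \<in> carrier K" if "i \<in> I" for i
    using insert.prems(2) that by (auto simp: carrier_free_sum split: if_splits)
  \<comment> \<open>Splitting off the coordinate \<open>s\<close> leaves a vector supported in the
    smaller set.\<close>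
  let ?y = "x(s := \<zero>\<^bsub>K\<^esub>)"
  have "finite {i \<in> I. ?y i \<noteq> \<zero>\<^bsub>K\<^esub>}"
    using insert.prems(2) unfolding carrier_free_sum by (auto elim: rev_finite_subset)
  then have y: "?y \<in> carrier (obj (free_sum K I a) p)"
    using insert.prems(2) s unfolding carrier_free_sum by (auto simp: extensional_def)
  note u = unit_at_carrier[OF K, where a = a and p = p and I = I]
  have Tu: "T (unit_at K I i) k \<in> carrier K" if "i \<in> insert s S" for i
  proof -
    have "T (unit_at K I i) \<in> carrier (obj (free_sum K I' b) q)"
      using insert.prems(1) that by (intro linear_mapD(3)[OF T] u) auto
    then show ?thesis using k by (auto simp: carrier_free_sum split: if_splits)
  qed
  have "x = ?y \<oplus>\<^bsub>obj (free_sum K I a) p\<^esub> x s \<odot>\<^bsub>obj (free_sum K I a) p\<^esub> unit_at K I s"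
    using insert.prems(2) s xs
    by (intro extensionalityI[of _ I]) (auto simp: free_sum_simps unit_at_def carrier_free_sum)
  then have "T x = T (?y \<oplus>\<^bsub>obj (free_sum K I a) p\<^esub> x s \<odot>\<^bsub>obj (free_sum K I a) p\<^esub> unit_at K I s)"
    by simp
  also have "\<dots> = T ?y \<oplus>\<^bsub>obj (free_sum K I' b) q\<^esub> x s \<odot>\<^bsub>obj (free_sum K I' b) q\<^esub> T (unit_at K I s)"
  proof -
    interpret V: vectorspace K "obj (free_sum K I a) p" using linear_mapD(1)[OF T] .
    show ?thesis using y u[OF s(2)] xs[OF s(1)] by (simp add: linear_mapD[OF T])
  qed
  finally have "T x k = T ?y k \<oplus>\<^bsub>K\<^esub> x s \<otimes>\<^bsub>K\<^esub> T (unit_at K I s) k"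
    using k by (simp add: free_sum_simps)
  also have "T ?y k = (\<Oplus>\<^bsub>K\<^esub>i\<in>S. ?y i \<otimes>\<^bsub>K\<^esub> T (unit_at K I i) k)"
    by (rule insert.IH[OF _ y]) (use insert.prems in auto)
  also have "\<dots> = (\<Oplus>\<^bsub>K\<^esub>i\<in>S. x i \<otimes>\<^bsub>K\<^esub> T (unit_at K I i) k)"
    using insert.hyps insert.prems(1) xs Tu by (intro finsum_cong') auto
  also have "\<dots> \<oplus>\<^bsub>K\<^esub> x s \<otimes>\<^bsub>K\<^esub> T (unit_at K I s) k = (\<Oplus>\<^bsub>K\<^esub>i\<in>insert s S. x i \<otimes>\<^bsub>K\<^esub> T (unit_at K I i) k)"
    using insert.hyps insert.prems(1) xs Tu
    by (subst finsum_insert) (auto intro!: a_comm finsum_closed)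
  finally show ?case .
qed

text \<open>The triangle at \<open>M\<close> is evaluated at the generator \<open>i\<close> and read
  off in coordinate \<open>i'\<close>. The sum runs over the support of row \<open>i\<close>, which
  is finite even if \<open>I'\<close> is not.\<close>

lemma interleaving_matrix_product:
  fixes a :: "'i \<Rightarrow> real \<times> real" and b :: "'j \<Rightarrow> real \<times> real"
  assumes K: "field K" and e: "0 \<le> \<epsilon>"
    and f: "pm_hom K (free_sum K I a) (pm_shift \<epsilon> (free_sum K I' b)) f"
    and g: "pm_hom K (free_sum K I' b) (pm_shift \<epsilon> (free_sum K I a)) g"
    and gf: "pm_eq (free_sum K I a) (pm_comp (hom_shift \<epsilon> g) f) (trans_hom (2 * \<epsilon>) (free_sum K I a))"
  defines "F \<equiv> \<lambda>i j. f (a i) (unit_at K I i) j" and "G \<equiv> \<lambda>j i. g (b j) (unit_at K I' j) i"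
  assumes ij: "i \<in> I" "i' \<in> I"
  shows "(\<Oplus>\<^bsub>K\<^esub>j\<in>{j \<in> I'. F i j \<noteq> \<zero>\<^bsub>K\<^esub>}. F i j \<otimes>\<^bsub>K\<^esub> G j i') = (if i = i' then \<one>\<^bsub>K\<^esub> else \<zero>\<^bsub>K\<^esub>)"
proof -
  interpret field K by fact
  let ?M = "free_sum K I a" and ?N = "free_sum K I' b" and ?e = "(\<epsilon>, \<epsilon>)"
  let ?S = "{j \<in> I'. F i j \<noteq> \<zero>\<^bsub>K\<^esub>}"
  let ?y = "f (a i) (unit_at K I i)"
  have ui: "unit_at K I i \<in> carrier (obj ?M (a i))" by (rule unit_at_carrier[OF K order_refl])
  have y: "?y \<in> carrier (obj ?N (a i + ?e))"
    using linear_mapD(3)[OF pm_hom_linear[OF f] ui] by (simp add: pm_shift_def)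
  have fin: "finite ?S" using y by (simp add: F_def carrier_free_sum)
  have sub: "?S \<subseteq> {j \<in> I'. b j \<le> a i + ?e}" using y by (auto simp: F_def carrier_free_sum split: if_splits)
  have T: "linear_map K (obj ?N (a i + ?e)) (obj ?M (a i + ?e + ?e)) (g (a i + ?e))"
    using pm_hom_linear[OF g, of "a i + ?e"] by (simp add: pm_shift_def)
  have Gu: "g (a i + ?e) (unit_at K I' j) i' = G j i'" and Gc: "G j i' \<in> carrier K" and Fc: "F i j \<in> carrier K"
    if j: "j \<in> ?S" for j
  proof -
    have bj: "b j \<le> a i + ?e" "j \<in> I'" using sub j by auto
    have uj: "unit_at K I' j \<in> carrier (obj ?N (b j))" by (rule unit_at_carrier[OF K order_refl])
    have gu: "g (b j) (unit_at K I' j) \<in> carrier (obj ?M (b j + ?e))"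
      using linear_mapD(3)[OF pm_hom_linear[OF g] uj] by (simp add: pm_shift_def)
    then show "G j i' \<in> carrier K" using ij by (auto simp: G_def carrier_free_sum split: if_splits)
    show "F i j \<in> carrier K" using y bj by (auto simp: F_def carrier_free_sum split: if_splits)
    \<comment> \<open>Column \<open>j\<close> of \<open>G\<close> is defined at \<open>b j\<close>,
      but \<open>g\<close> is applied at \<open>a i + ?e\<close>. The internal map between these
      points fixes the generator, so naturality transports the column.\<close>
    have "imap ?N (b j) (a i + ?e) (unit_at K I' j) = unit_at K I' j"
      using bj by (auto simp: free_sum_simps unit_at_def)
    then have "g (a i + ?e) (unit_at K I' j) = g (a i + ?e) (imap ?N (b j) (a i + ?e) (unit_at K I' j))"
      by simp
    also have "\<dots> = imap ?M (b j + ?e) (a i + ?e + ?e) (g (b j) (unit_at K I' j))"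
      using pm_hom_natural[OF g bj(1) uj] by (simp add: pm_shift_def)
    finally have *: "g (a i + ?e) (unit_at K I' j) i' =
        (if a i' \<le> b j + ?e \<and> a i' \<le> a i + ?e + ?e then G j i' else \<zero>\<^bsub>K\<^esub>)"
      using ij by (simp add: free_sum_simps G_def)
    have "a i' \<le> a i + ?e + ?e" if "a i' \<le> b j + ?e"
      using that bj by (auto simp: less_eq_prod_def)
    moreover have "G j i' = \<zero>\<^bsub>K\<^esub>" if "\<not> a i' \<le> b j + ?e"
      using gu that ij by (auto simp: G_def carrier_free_sum)
    ultimately show "g (a i + ?e) (unit_at K I' j) i' = G j i'" using * by auto
  qed
  have "g (a i + ?e) ?y i' = (\<Oplus>\<^bsub>K\<^esub>j\<in>?S. F i j \<otimes>\<^bsub>K\<^esub> g (a i + ?e) (unit_at K I' j) i')"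
    unfolding F_def
    by (rule linear_map_free_sum_coordinate[OF K T ij(2) _ _ y]) (use fin sub in \<open>auto simp: F_def\<close>)
  also have "\<dots> = (\<Oplus>\<^bsub>K\<^esub>j\<in>?S. F i j \<otimes>\<^bsub>K\<^esub> G j i')"
    using Gu Gc Fc by (intro finsum_cong') auto
  finally have "(\<Oplus>\<^bsub>K\<^esub>j\<in>?S. F i j \<otimes>\<^bsub>K\<^esub> G j i') = g (a i + ?e) ?y i'" ..
  also have "g (a i + ?e) ?y = imap ?M (a i) (a i + (2 * \<epsilon>, 2 * \<epsilon>)) (unit_at K I i)"
    using gf ui by (auto simp: pm_eq_def pm_comp_def hom_shift_def trans_hom_def)
  also have "\<dots> i' = (if i = i' then \<one>\<^bsub>K\<^esub> else \<zero>\<^bsub>K\<^esub>)"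
    using ij e by (auto simp: free_sum_simps unit_at_def less_eq_prod_def)
  finally show ?thesis .
qed

section \<open>Hall's condition and bijections of generators\<close>

text \<open>The product of matrices is cut down to the rows in \<open>A\<close> and the columns in
  \<open>?B\<close>, with the coordinate sum as \<open>\<alpha>\<close>. By
  \<open>close_either_end\<close> the columns outside \<open>?B\<close> contribute nothing to
  entries with ordered indices, so these keep their values.\<close>

lemma interleaved_free_sum_hall:
  fixes a :: "'i \<Rightarrow> real \<times> real" and b :: "'j \<Rightarrow> real \<times> real"
  assumes K: "field K" and e: "0 \<le> \<epsilon>"
    and MN: "interleaved K \<epsilon> (free_sum K I a) (free_sum K I' b)"
    and fin: "\<And>i. i \<in> I \<Longrightarrow> finite {j \<in> I'. close \<epsilon> (a i) (b j)}"
    and A: "A \<subseteq> I" "finite A"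
  shows "card A \<le> card (\<Union>i\<in>A. {j \<in> I'. close \<epsilon> (a i) (b j)})"
proof -
  interpret field K by fact
  let ?M = "free_sum K I a" and ?N = "free_sum K I' b" and ?e = "(\<epsilon>, \<epsilon>)"
  obtain f g where f: "pm_hom K ?M (pm_shift \<epsilon> ?N) f" and g: "pm_hom K ?N (pm_shift \<epsilon> ?M) g"
    and gf: "pm_eq ?M (pm_comp (hom_shift \<epsilon> g) f) (trans_hom (2 * \<epsilon>) ?M)"
    using MN unfolding interleaved_def by blast
  define F where "F i j = f (a i) (unit_at K I i) j" for i j
  define G where "G j i = g (b j) (unit_at K I' j) i" for j i
  have y: "f (a i) (unit_at K I i) \<in> carrier (obj ?N (a i + ?e))" for i
    using linear_mapD(3)[OF pm_hom_linear[OF f] unit_at_carrier[OF K order_refl]]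
    by (simp add: pm_shift_def)
  have z: "g (b j) (unit_at K I' j) \<in> carrier (obj ?M (b j + ?e))" for j
    using linear_mapD(3)[OF pm_hom_linear[OF g] unit_at_carrier[OF K order_refl]]
    by (simp add: pm_shift_def)
  have F: "F i j \<in> carrier K" "F i j \<noteq> \<zero>\<^bsub>K\<^esub> \<Longrightarrow> b j \<le> a i + ?e" if "j \<in> I'" for i j
    using y[of i] that by (auto simp: F_def carrier_free_sum split: if_splits)
  have G: "G j i \<in> carrier K" "G j i \<noteq> \<zero>\<^bsub>K\<^esub> \<Longrightarrow> a i \<le> b j + ?e" if "i \<in> I" for i j
    using z[of j] that by (auto simp: G_def carrier_free_sum split: if_splits)
  let ?S = "\<lambda>i. {j \<in> I'. F i j \<noteq> \<zero>\<^bsub>K\<^esub>}"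
  have finS: "finite (?S i)" for i
    using y[of i] by (simp add: F_def carrier_free_sum)
  have FG: "(\<Oplus>\<^bsub>K\<^esub>j\<in>?S i. F i j \<otimes>\<^bsub>K\<^esub> G j i') = (if i = i' then \<one>\<^bsub>K\<^esub> else \<zero>\<^bsub>K\<^esub>)"
    if "i \<in> I" "i' \<in> I" for i i'
    unfolding F_def G_def by (rule interleaving_matrix_product[OF K e f g gf that])
  let ?B = "\<Union>i\<in>A. {j \<in> I'. close \<epsilon> (a i) (b j)}"
  show ?thesis
  proof (rule card_le_of_unitriangular_product[where \<alpha> = "\<lambda>i. fst (a i) + snd (a i)"])
    show finB: "finite ?B" using A fin by blast
    show "F i j \<in> carrier K" "G j i \<in> carrier K" if "i \<in> A" "j \<in> ?B" for i j
      using that F G A by auto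
    fix i i' assume i: "i \<in> A" "i' \<in> A" and le: "fst (a i) + snd (a i) \<le> fst (a i') + snd (a i')"
    have out: "F i j \<otimes>\<^bsub>K\<^esub> G j i' = \<zero>\<^bsub>K\<^esub>" if j: "j \<in> I'" "j \<notin> ?B" for j
    proof (rule ccontr)
      assume "F i j \<otimes>\<^bsub>K\<^esub> G j i' \<noteq> \<zero>\<^bsub>K\<^esub>"
      then have "F i j \<noteq> \<zero>\<^bsub>K\<^esub>" "G j i' \<noteq> \<zero>\<^bsub>K\<^esub>"
        using F G i A j by (metis l_null r_null subsetD)+
      then have "close \<epsilon> (a i) (b j) \<or> close \<epsilon> (a i') (b j)"
        using F G i A j le by (intro close_either_end) auto
      then show False using i j by auto
    qed
    \<comment> \<open>Terms in only one of the two index sets vanish: by \<open>out\<close> if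
      \<open>j\<close> is not in \<open>?B\<close>, and by \<open>F i j = \<zero>\<close> if it is
      not in \<open>?S i\<close>.\<close>
    have "(\<Oplus>\<^bsub>K\<^esub>j\<in>?B. F i j \<otimes>\<^bsub>K\<^esub> G j i') = (\<Oplus>\<^bsub>K\<^esub>j\<in>?S i. F i j \<otimes>\<^bsub>K\<^esub> G j i')"
    proof (rule add.finprod_mono_neutral_cong)
      show "F i j \<otimes>\<^bsub>K\<^esub> G j i' = \<zero>\<^bsub>K\<^esub>" if "j \<in> ?S i - ?B" for j
        using that out by blast
      show "F i j \<otimes>\<^bsub>K\<^esub> G j i' = \<zero>\<^bsub>K\<^esub>" if "j \<in> ?B - ?S i" for j
      proof -
        have "F i j = \<zero>\<^bsub>K\<^esub>" using that by blast
        then show ?thesis using G(1)[of i' j] i A by auto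
      qed
    qed (use F G i A finB finS in auto)
    then show "(\<Oplus>\<^bsub>K\<^esub>j\<in>?B. F i j \<otimes>\<^bsub>K\<^esub> G j i') = (if i = i' then \<one>\<^bsub>K\<^esub> else \<zero>\<^bsub>K\<^esub>)"
      using FG[of i i'] i A by (simp add: subsetD)
  qed (rule A)
qed

text \<open>Hall's theorem in both directions gives injections along close pairs. Each value of the
  combined bijection comes from one of them, and closeness is symmetric.\<close>

lemma interleaved_free_sum_imp_bij:
  fixes a :: "'i \<Rightarrow> real \<times> real" and b :: "'j \<Rightarrow> real \<times> real"
  assumes K: "field K" and e: "0 \<le> \<epsilon>"
    and MN: "interleaved K \<epsilon> (free_sum K I a) (free_sum K I' b)"
    and fin: "\<And>p. finite {i \<in> I. a i \<le> p}" "\<And>p. finite {j \<in> I'. b j \<le> p}"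
  shows "\<exists>\<sigma>. bij_betw \<sigma> I I' \<and> (\<forall>i\<in>I. close \<epsilon> (a i) (b (\<sigma> i)))"
proof -
  have fin1: "finite {j \<in> I'. close \<epsilon> (a i) (b j)}" for i
    by (rule finite_subset[OF _ fin(2)[of "a i + (\<epsilon>, \<epsilon>)"]]) (auto simp: close_def)
  have fin2: "finite {i \<in> I. close \<epsilon> (b j) (a i)}" for j
    by (rule finite_subset[OF _ fin(1)[of "b j + (\<epsilon>, \<epsilon>)"]]) (auto simp: close_def)
  obtain f where f: "inj_on f I" "\<forall>i\<in>I. f i \<in> {j \<in> I'. close \<epsilon> (a i) (b j)}"
    using marriage_locally_finite[of I "\<lambda>i. {j \<in> I'. close \<epsilon> (a i) (b j)}"] fin1
      interleaved_free_sum_hall[OF K e MN] by blast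
  obtain g where g: "inj_on g I'" "\<forall>j\<in>I'. g j \<in> {i \<in> I. close \<epsilon> (b j) (a i)}"
    using marriage_locally_finite[of I' "\<lambda>j. {i \<in> I. close \<epsilon> (b j) (a i)}"] fin2
      interleaved_free_sum_hall[OF K e interleaved_sym[OF MN]] by blast
  have "f ` I \<subseteq> I'" "g ` I' \<subseteq> I" using f g by auto
  then obtain h where h: "bij_betw h I I'" "\<forall>i\<in>I. h i = f i \<or> g (h i) = i"
    using bij_betw_from_two_injections[OF f(1) _ g(1)] by blast
  have "close \<epsilon> (a i) (b (h i))" if i: "i \<in> I" for i
  proof -
    have "h i \<in> I'" using h(1) i by (auto simp: bij_betw_def)
    then have "close \<epsilon> (b (h i)) (a (g (h i)))" using g(2) by blast
    moreover have "close \<epsilon> (a i) (b (f i))" using f(2) i by blast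
    moreover have "h i = f i \<or> g (h i) = i" using h(2) i by blast
    ultimately show ?thesis using close_sym by metis
  qed
  with h(1) show ?thesis by blast
qed

section \<open>Interleavings from bijections of generators\<close>

text \<open>Coordinates are pulled back along \<open>\<tau>\<close>. The inequality ensures that
  coordinate \<open>j\<close> is already allowed in the shifted target wherever coordinate
  \<open>\<tau> j\<close> is in the source.\<close>

lemma pm_hom_reindex:
  assumes K: "field K" and \<tau>: "bij_betw \<tau> I' I" and le: "\<And>j. j \<in> I' \<Longrightarrow> b j \<le> a (\<tau> j) + (\<epsilon>, \<epsilon>)"
  shows "pm_hom K (free_sum K I a) (pm_shift \<epsilon> (free_sum K I' b)) (\<lambda>p x. \<lambda>j\<in>I'. x (\<tau> j))"
proof -
  have \<tau>I: "\<tau> j \<in> I" if "j \<in> I'" for j using \<tau> that by (auto simp: bij_betw_def)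
  have le': "b j \<le> p + (\<epsilon>, \<epsilon>)" if "j \<in> I'" "a (\<tau> j) \<le> p" for j p
    using le[OF that(1)] that(2) by (auto simp: less_eq_prod_def)
  have vs: "vectorspace K (obj (free_sum K J c) p)" for J :: "'z set" and c p
    using persistence_module_free_sum[OF K] by (rule persistence_module.vectorspace_obj)
  have closed: "(\<lambda>j\<in>I'. x (\<tau> j)) \<in> carrier (obj (free_sum K I' b) (p + (\<epsilon>, \<epsilon>)))"
    if x: "x \<in> carrier (obj (free_sum K I a) p)" for x p
  proof -
    have "finite (\<tau> -` {i \<in> I. x i \<noteq> \<zero>\<^bsub>K\<^esub>} \<inter> I')"
      using x \<tau> by (intro finite_vimage_IntI) (auto simp: carrier_free_sum bij_betw_def)
    moreover have "\<tau> -` {i \<in> I. x i \<noteq> \<zero>\<^bsub>K\<^esub>} \<inter> I' = {j \<in> I'. (\<lambda>j\<in>I'. x (\<tau> j)) j \<noteq> \<zero>\<^bsub>K\<^esub>}"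
      using \<tau>I by auto
    moreover have "\<zero>\<^bsub>K\<^esub> \<in> carrier K"
      using K by (simp add: field_def domain_def cring_def ring.ring_simprules)
    moreover have "x (\<tau> j) \<in> (if b j \<le> p + (\<epsilon>, \<epsilon>) then carrier K else {\<zero>\<^bsub>K\<^esub>})" if "j \<in> I'" for j
      using x \<tau>I[OF that] le'[OF that, of p] \<open>\<zero>\<^bsub>K\<^esub> \<in> carrier K\<close>
      unfolding carrier_free_sum by (metis singletonD)
    ultimately show ?thesis unfolding carrier_free_sum by simp
  qed
  show ?thesis
    unfolding pm_hom_def
  proof (intro conjI allI impI ballI)
    show "linear_map K (obj (free_sum K I a) p) (obj (pm_shift \<epsilon> (free_sum K I' b)) p) (\<lambda>x. \<lambda>j\<in>I'. x (\<tau> j))"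
      for p
      using closed \<tau>I vs[of I] vs[of I'] by (intro linear_mapI) (auto simp: pm_shift_def free_sum_simps)
    show "(\<lambda>j\<in>I'. imap (free_sum K I a) p q x (\<tau> j)) =
        imap (pm_shift \<epsilon> (free_sum K I' b)) p q (\<lambda>j\<in>I'. x (\<tau> j))"
      if pq: "p \<le> q" and x: "x \<in> carrier (obj (free_sum K I a) p)" for p q x
    proof (rule extensionalityI[of _ I'])
      fix j assume j: "j \<in> I'"
      have "x (\<tau> j) = \<zero>\<^bsub>K\<^esub>" if "\<not> a (\<tau> j) \<le> p"
        using x \<tau>I[OF j] that by (auto simp: carrier_free_sum)
      moreover have "a (\<tau> j) \<le> q" if "a (\<tau> j) \<le> p" using that pq by (rule order_trans)
      ultimately show "(\<lambda>j\<in>I'. imap (free_sum K I a) p q x (\<tau> j)) j =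
          imap (pm_shift \<epsilon> (free_sum K I' b)) p q (\<lambda>j\<in>I'. x (\<tau> j)) j"
        using j \<tau>I le' by (auto simp: pm_shift_def free_sum_simps)
    qed (auto simp: pm_shift_def free_sum_simps)
  qed
qed

text \<open>Reindexing forth and back leaves the coordinates unchanged; so does the internal map,
  since a nonzero coordinate at \<open>p\<close> has its generator below \<open>p\<close>.\<close>

lemma pm_comp_reindex:
  assumes e: "0 \<le> \<epsilon>" and \<sigma>: "\<And>i. i \<in> I \<Longrightarrow> \<sigma> i \<in> I'" "\<And>i. i \<in> I \<Longrightarrow> \<tau> (\<sigma> i) = i"
  shows "pm_eq (free_sum K I a) (pm_comp (hom_shift \<epsilon> (\<lambda>p x. \<lambda>i\<in>I. x (\<sigma> i))) (\<lambda>p x. \<lambda>j\<in>I'. x (\<tau> j)))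
    (trans_hom (2 * \<epsilon>) (free_sum K I a))"
  unfolding pm_eq_def
proof (intro allI ballI)
  fix p x assume x: "x \<in> carrier (obj (free_sum K I a) p)"
  have "p \<le> p + (2 * \<epsilon>, 2 * \<epsilon>)" using e by (simp add: less_eq_prod_def)
  then have "x i = (if a i \<le> p \<and> a i \<le> p + (2 * \<epsilon>, 2 * \<epsilon>) then x i else \<zero>\<^bsub>K\<^esub>)" if "i \<in> I" for i
    using x that order_trans[of "a i" p "p + (2 * \<epsilon>, 2 * \<epsilon>)"] by (auto simp: carrier_free_sum split: if_splits)
  then show "pm_comp (hom_shift \<epsilon> (\<lambda>p x. \<lambda>i\<in>I. x (\<sigma> i))) (\<lambda>p x. \<lambda>j\<in>I'. x (\<tau> j)) p x =
      trans_hom (2 * \<epsilon>) (free_sum K I a) p x"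
    using \<sigma> by (auto simp: pm_comp_def hom_shift_def trans_hom_def free_sum_simps intro!: restrict_ext)
qed

lemma interleaved_free_sumI:
  assumes K: "field K" and e: "0 \<le> \<epsilon>" and \<sigma>: "bij_betw \<sigma> I I'"
    and cl: "\<And>i. i \<in> I \<Longrightarrow> close \<epsilon> (a i) (b (\<sigma> i))"
  shows "interleaved K \<epsilon> (free_sum K I a) (free_sum K I' b)"
proof -
  let ?\<tau> = "the_inv_into I \<sigma>"
  have \<tau>: "bij_betw ?\<tau> I' I" by (rule bij_betw_the_inv_into[OF \<sigma>])
  have 1: "\<sigma> i \<in> I'" "?\<tau> (\<sigma> i) = i" if "i \<in> I" for i
    using \<sigma> that by (auto simp: bij_betw_def the_inv_into_f_f)
  have 2: "?\<tau> j \<in> I" "\<sigma> (?\<tau> j) = j" if "j \<in> I'" for j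
    using \<sigma> \<tau> that by (auto simp: bij_betw_def f_the_inv_into_f)
  have "pm_hom K (free_sum K I a) (pm_shift \<epsilon> (free_sum K I' b)) (\<lambda>p x. \<lambda>j\<in>I'. x (?\<tau> j))"
    by (rule pm_hom_reindex[OF K \<tau>]) (use cl 2 in \<open>metis close_def\<close>)
  moreover have "pm_hom K (free_sum K I' b) (pm_shift \<epsilon> (free_sum K I a)) (\<lambda>p x. \<lambda>i\<in>I. x (\<sigma> i))"
    by (rule pm_hom_reindex[OF K \<sigma>]) (use cl in \<open>auto simp: close_def\<close>)
  ultimately show ?thesis
    unfolding interleaved_def
    by (intro exI[of _ "\<lambda>p x. \<lambda>j\<in>I'. x (?\<tau> j)"] exI[of _ "\<lambda>p x. \<lambda>i\<in>I. x (\<sigma> i)"] conjI pm_comp_reindex e)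
      (use 1 2 in auto)
qed

text \<open>A finite spanning set of \<open>obj M p\<close> has images with finitely many nonzero
  coordinates altogether, collected in \<open>S\<close>. By linearity all images are supported in
  \<open>S\<close>, and every \<open>unit_at K I i\<close> with \<open>a i \<le> p\<close> is an
  image.\<close>

lemma finite_generators_below:
  assumes K: "field K" and fd: "vectorspace.fin_dim K (obj M p)"
    and iso: "pm_isomorphic K M (free_sum K I a)"
  shows "finite {i \<in> I. a i \<le> p}"
proof -
  interpret field K by fact
  obtain u v where u: "pm_hom K M (free_sum K I a) u" and v: "pm_hom K (free_sum K I a) M v"
    and uv: "pm_eq (free_sum K I a) (pm_comp u v) (\<lambda>p x. x)"
    using iso unfolding pm_isomorphic_def by blast
  note ul = pm_hom_linear[OF u, of p]
  interpret V: vectorspace K "obj M p" using linear_mapD(1)[OF ul] .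
  obtain B where B: "finite B" "B \<subseteq> carrier (obj M p)" "V.span B = carrier (obj M p)"
    using fd unfolding V.fin_dim_def by blast
  have ux: "u p x i \<in> carrier K" if "x \<in> carrier (obj M p)" "i \<in> I" for x i
    using linear_mapD(3)[OF ul that(1)] that(2) by (auto simp: carrier_free_sum split: if_splits)
  define S where "S = (\<Union>x\<in>B. {i \<in> I. u p x i \<noteq> \<zero>\<^bsub>K\<^esub>})"
  have "finite S"
    using B linear_mapD(3)[OF ul] by (auto simp: S_def carrier_free_sum)
  \<comment> \<open>A subspace containing the spanning set \<open>B\<close>, hence
    everything.\<close>
  define U where "U = {x \<in> carrier (obj M p). \<forall>i\<in>I - S. u p x i = \<zero>\<^bsub>K\<^esub>}"
  have "submodule K U (obj M p)"
  proof (unfold_locales)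
    show "U \<subseteq> carrier (obj M p)" by (auto simp: U_def)
    show "\<zero>\<^bsub>obj M p\<^esub> \<in> U" by (auto simp: U_def linear_mapD(6)[OF ul] free_sum_simps)
    show "x \<oplus>\<^bsub>obj M p\<^esub> y \<in> U" if "x \<in> U" "y \<in> U" for x y
      using that by (auto simp: U_def linear_mapD(4)[OF ul] free_sum_simps)
    show "c \<odot>\<^bsub>obj M p\<^esub> x \<in> U" if "c \<in> carrier K" "x \<in> U" for c x
      using that by (auto simp: U_def linear_mapD(5)[OF ul] free_sum_simps)
  qed
  moreover have "B \<subseteq> U" using B by (auto simp: U_def S_def)
  ultimately have "carrier (obj M p) \<subseteq> U" using B V.span_is_subset by metis
  have "i \<in> S" if i: "i \<in> I" "a i \<le> p" for i
  proof (rule ccontr)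
    assume "i \<notin> S"
    have e: "unit_at K I i \<in> carrier (obj (free_sum K I a) p)"
      by (rule unit_at_carrier[OF K, of a i p, OF i(2)])
    then have "v p (unit_at K I i) \<in> U"
      using linear_mapD(3)[OF pm_hom_linear[OF v]] \<open>carrier (obj M p) \<subseteq> U\<close> by blast
    then have "u p (v p (unit_at K I i)) i = \<zero>\<^bsub>K\<^esub>" using i \<open>i \<notin> S\<close> by (auto simp: U_def)
    moreover have "u p (v p (unit_at K I i)) = unit_at K I i"
      using uv e by (auto simp: pm_eq_def pm_comp_def)
    ultimately show False using i by (simp add: unit_at_def)
  qed
  then show ?thesis using \<open>finite S\<close> by (auto intro: finite_subset)
qed

section \<open>Barcodes\<close>

lemma interleaved_free_imp_bij:
  assumes K: "field K" and e: "0 \<le> \<epsilon>"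
    and pfd: "pointwise_fin_dim K M" "pointwise_fin_dim K N"
    and M: "pm_isomorphic K M (free_sum K I a)" and N: "pm_isomorphic K N (free_sum K I' b)"
    and MN: "interleaved K \<epsilon> M N"
  shows "\<exists>\<sigma>. bij_betw \<sigma> I I' \<and> (\<forall>i\<in>I. close \<epsilon> (a i) (b (\<sigma> i)))"
  by (rule interleaved_free_sum_imp_bij[OF K e interleaved_cong_isomorphic[OF e M N MN]])
    (use pfd in \<open>auto simp: pointwise_fin_dim_def intro: finite_generators_below[OF K _ M] finite_generators_below[OF K _ N]\<close>)

text \<open>Two decompositions of \<open>M\<close> yield 0-interleaved sums, hence a bijection
  between indices with equal generators, and so equal multiplicities. This justifies the definite
  description in \<open>barcode\<close>.\<close>

lemma barcode_eq:
  fixes M :: "('k, 'v) persmod" and I :: "((real \<times> real) \<times> 'v) set"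
  assumes K: "field K" and M: "persistence_module K M" and pfd: "pointwise_fin_dim K M"
    and dec: "free_decomposition K M I J"
  shows "barcode K M = (\<lambda>\<J>. card {i \<in> I. J i = \<J>})"
  unfolding barcode_def
proof (rule the_equality)
  show "\<exists>(I' :: ((real \<times> real) \<times> 'v) set) J'. free_decomposition K M I' J' \<and>
      (\<lambda>\<J>. card {i \<in> I. J i = \<J>}) = (\<lambda>\<J>. card {i \<in> I'. J' i = \<J>})"
    using dec by blast
next
  fix C assume "\<exists>(I :: ((real \<times> real) \<times> 'v) set) J. free_decomposition K M I J \<and>
      C = (\<lambda>\<J>. card {i \<in> I. J i = \<J>})"
  then obtain I' :: "((real \<times> real) \<times> 'v) set" and J' where dec': "free_decomposition K M I' J'"
    and C: "C = (\<lambda>\<J>. card {i \<in> I'. J' i = \<J>})" by blast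
  obtain a where a: "\<And>i. i \<in> I \<Longrightarrow> J i = {q. a i \<le> q}" "pm_isomorphic K M (free_sum K I a)"
    using free_decompositionE[OF dec] by blast
  obtain b where b: "\<And>i. i \<in> I' \<Longrightarrow> J' i = {q. b i \<le> q}" "pm_isomorphic K M (free_sum K I' b)"
    using free_decompositionE[OF dec'] by blast
  obtain \<sigma> where \<sigma>: "bij_betw \<sigma> I I'" "\<forall>i\<in>I. close 0 (a i) (b (\<sigma> i))"
    using interleaved_free_imp_bij[OF K order_refl pfd pfd a(2) b(2) interleaved_refl[OF M]] by blast
  have J: "J' (\<sigma> i) = J i" if "i \<in> I" for i
    using \<sigma>(2) that a(1)[OF that] b(1)[OF bij_betwE[OF \<sigma>(1), rule_format, OF that]]
    by (simp add: close_0_iff)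
  have "card {i \<in> I'. J' i = \<J>} = card {i \<in> I. J i = \<J>}" for \<J>
  proof -
    have "{i \<in> I'. J' i = \<J>} = \<sigma> ` {i \<in> I. J' (\<sigma> i) = \<J>}"
      unfolding bij_betw_imp_surj_on[OF \<sigma>(1), symmetric] by (rule Compr_image_eq)
    also have "{i \<in> I. J' (\<sigma> i) = \<J>} = {i \<in> I. J i = \<J>}"
      by (intro Collect_cong conj_cong refl) (simp only: J)
    finally show ?thesis
      by (simp only:) (rule card_image, rule inj_on_subset[OF bij_betw_imp_inj_on[OF \<sigma>(1)]], blast)
  qed
  then show "C = (\<lambda>\<J>. card {i \<in> I. J i = \<J>})" by (simp add: C)
qed

text \<open>Lets the remaining argument work with indexed generators instead of multisets.\<close>

lemma free_pmE:
  fixes M :: "('k, 'v) persmod"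
  assumes K: "field K" and M: "persistence_module K M" and pfd: "pointwise_fin_dim K M"
    and free: "free_pm K M"
  obtains I :: "((real \<times> real) \<times> 'v) set" and a \<tau> where "pm_isomorphic K M (free_sum K I a)"
    "bij_betw \<tau> I (copies (barcode K M))" "\<And>i. i \<in> I \<Longrightarrow> fst (\<tau> i) = {q. a i \<le> q}"
proof -
  obtain I :: "((real \<times> real) \<times> 'v) set" and J where dec: "free_decomposition K M I J"
    using free unfolding free_pm_def by blast
  obtain a where a: "\<And>i. i \<in> I \<Longrightarrow> J i = {q. a i \<le> q}" and iso: "pm_isomorphic K M (free_sum K I a)"
    using free_decompositionE[OF dec] by blast
  have "finite {i \<in> I. J i = \<J>}" for \<J>
  proof (cases "\<exists>k\<in>I. J k = \<J>")
    case True
    then obtain k where k: "k \<in> I" "J k = \<J>" by blast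
    \<comment> \<open>Equal upsets have equal generators, and only finitely many generators are
      \<open>\<le> a k\<close>.\<close>
    then have "{i \<in> I. J i = \<J>} \<subseteq> {i \<in> I. a i \<le> a k}"
      using a by (auto simp: upset_eq_iff)
    then show ?thesis
      using finite_generators_below[OF K _ iso, of "a k"] pfd
      by (auto simp: pointwise_fin_dim_def intro: finite_subset)
  next
    case False
    then have "{i \<in> I. J i = \<J>} = {}" by blast
    then show ?thesis by (simp only: finite.emptyI)
  qed
  then obtain \<tau> where "bij_betw \<tau> I (copies (barcode K M))" "\<forall>i. fst (\<tau> i) = J i"
    using bij_betw_copies[of I J] unfolding barcode_eq[OF K M pfd dec] by blast
  then show thesis using that[OF iso] a by auto
qed

theorem corollary6p6:
  fixes K :: "('k, 'r) ring_scheme"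
    and M :: "('k, 'v) persmod"
    and N :: "('k, 'w) persmod"
    and \<epsilon> :: real
  assumes "field K"
    and "0 \<le> \<epsilon>"
    and "persistence_module K M" and "pointwise_fin_dim K M" and "free_pm K M"
    and "persistence_module K N" and "pointwise_fin_dim K N" and "free_pm K N"
  shows "interleaved K \<epsilon> M N \<longleftrightarrow>
    (\<exists>C' D' \<sigma>. is_matching K \<epsilon> (barcode K M) (barcode K N) C' D' \<sigma>)"
proof -
  note K = assms(1) and e = assms(2)
  obtain I :: "((real \<times> real) \<times> 'v) set" and a \<tau> where isoM: "pm_isomorphic K M (free_sum K I a)"
    and \<tau>: "bij_betw \<tau> I (copies (barcode K M))" and fst\<tau>: "\<And>i. i \<in> I \<Longrightarrow> fst (\<tau> i) = {q. a i \<le> q}"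
    using free_pmE[OF K assms(3-5)] by blast
  obtain I' :: "((real \<times> real) \<times> 'w) set" and b \<tau>' where isoN: "pm_isomorphic K N (free_sum K I' b)"
    and \<tau>': "bij_betw \<tau>' I' (copies (barcode K N))" and fst\<tau>': "\<And>j. j \<in> I' \<Longrightarrow> fst (\<tau>' j) = {q. b j \<le> q}"
    using free_pmE[OF K assms(6-8)] by blast
  let ?C = "copies (barcode K M)" and ?D = "copies (barcode K N)"
  have memC: "\<tau> i \<in> ?C" if "i \<in> I" for i using \<tau> that by (auto simp: bij_betw_def)
  show ?thesis
  proof
    assume "interleaved K \<epsilon> M N"
    then obtain s where s: "bij_betw s I I'" "\<forall>i\<in>I. close \<epsilon> (a i) (b (s i))"
      using interleaved_free_imp_bij[OF K e assms(4,7) isoM isoN] by blast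
    let ?i = "the_inv_into I \<tau>"
    have i: "?i p \<in> I" "\<tau> (?i p) = p" if "p \<in> ?C" for p
      using that \<tau> bij_betw_the_inv_into[OF \<tau>] by (auto simp: bij_betw_def f_the_inv_into_f)
    \<comment> \<open>The bijection of generators is transported along \<open>\<tau>\<close> and
      \<open>\<tau>'\<close>; it matches all bars, so \<open>C'\<close> and \<open>D'\<close> are
      taken to be the full sets of copies.\<close>
    have bij: "bij_betw (\<tau>' \<circ> (s \<circ> ?i)) ?C ?D"
      using bij_betw_the_inv_into[OF \<tau>] s(1) \<tau>' by (blast intro: bij_betw_trans)
    have "intervals_interleaved K \<epsilon> (fst p) (fst ((\<tau>' \<circ> (s \<circ> ?i)) p))" if p: "p \<in> ?C" for p
    proof -
      have "s (?i p) \<in> I'" using s(1) i(1)[OF p] by (auto simp: bij_betw_def)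
      then have "fst ((\<tau>' \<circ> (s \<circ> ?i)) p) = {q. b (s (?i p)) \<le> q}" using fst\<tau>' by simp
      moreover have "fst p = {q. a (?i p) \<le> q}" using fst\<tau>[OF i(1)[OF p]] i(2)[OF p] by simp
      ultimately show ?thesis
        using s(2) i(1)[OF p] intervals_interleaved_upset_iff[OF K e] by simp
    qed
    with bij have "is_matching K \<epsilon> (barcode K M) (barcode K N) ?C ?D (\<tau>' \<circ> (s \<circ> ?i))"
      unfolding is_matching_def by blast
    then show "\<exists>C' D' \<sigma>. is_matching K \<epsilon> (barcode K M) (barcode K N) C' D' \<sigma>" by blast
  next
    assume "\<exists>C' D' \<sigma>. is_matching K \<epsilon> (barcode K M) (barcode K N) C' D' \<sigma>"
    then obtain C' D' \<sigma> where m: "is_matching K \<epsilon> (barcode K M) (barcode K N) C' D' \<sigma>" by blast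
    \<comment> \<open>No bar is \<open>2 * \<epsilon>\<close>-trivial, so the matching is a
      bijection between the full barcodes and can be carried back to the generators.\<close>
    have nontriv: "\<not> interval_trivial K (2 * \<epsilon>) {q. p \<le> q}" for p
      using interval_not_trivial_upset[OF K] e by simp
    have "\<exists>i\<in>I. p = \<tau> i" if "p \<in> ?C" for p using that \<tau> by (auto simp: bij_betw_def)
    then have "C' = ?C" using m fst\<tau> nontriv unfolding is_matching_def by (metis subsetI subset_antisym)
    moreover have "\<exists>j\<in>I'. q = \<tau>' j" if "q \<in> ?D" for q using that \<tau>' by (auto simp: bij_betw_def)
    then have "D' = ?D" using m fst\<tau>' nontriv unfolding is_matching_def by (metis subsetI subset_antisym)
    ultimately have \<sigma>: "bij_betw \<sigma> ?C ?D"
      and int: "\<And>p. p \<in> ?C \<Longrightarrow> intervals_interleaved K \<epsilon> (fst p) (fst (\<sigma> p))"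
      using m by (auto simp: is_matching_def)
    let ?j = "the_inv_into I' \<tau>'"
    let ?s = "?j \<circ> (\<sigma> \<circ> \<tau>)"
    have s: "bij_betw ?s I I'"
      using \<tau> \<sigma> bij_betw_the_inv_into[OF \<tau>'] by (blast intro: bij_betw_trans)
    have "close \<epsilon> (a i) (b (?s i))" if i: "i \<in> I" for i
    proof -
      have "\<sigma> (\<tau> i) \<in> ?D" using \<sigma> memC[OF i] by (auto simp: bij_betw_def)
      then have "\<tau>' (?s i) = \<sigma> (\<tau> i)" using \<tau>' by (auto simp: bij_betw_def f_the_inv_into_f)
      moreover have "?s i \<in> I'" using s i by (auto simp: bij_betw_def)
      ultimately have "fst (\<sigma> (\<tau> i)) = {q. b (?s i) \<le> q}" using fst\<tau>' by metis
      then show ?thesis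
        using int[OF memC[OF i]] fst\<tau>[OF i] intervals_interleaved_upset_iff[OF K e] by simp
    qed
    then have "interleaved K \<epsilon> (free_sum K I a) (free_sum K I' b)"
      by (rule interleaved_free_sumI[OF K e s])
    then show "interleaved K \<epsilon> M N"
      by (rule interleaved_cong_isomorphic[OF e pm_isomorphic_sym[OF isoM] pm_isomorphic_sym[OF isoN]])
  qed
qed

end
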